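(* Let $Z$ be a separable, reflexive Banach space, $Z_{\rm ad}\subset Z$ nonempty, closed, convex and bounded, $Y$ a separable Banach space, $Y_0\subset Y$ closed, and $p\in[1,\infty)$. Let $\mathbf{B}:Z\to Y$ be linear and completely continuous with $\mathbf{B}(Z_{\rm ad})\subset Y_0$, and let $\wp:Z\to[0,\infty)$ be convex and continuous. Let $(\Omega,\mathcal{F},P)$ be a nonatomic, complete probability space, and let $\xi:\Omega\to\Xi$ be a random element with law $\mathbb{P}=P\circ\xi^{-1}$. Let $f:Y_0\times\Xi\to\mathbb{R}$ be a Carathéodory function such that $f(y,\cdot)\in L^p(\Xi,\mathcal{A},\mathbb{P})$ for all $y\in Y_0$, and such that $F:Y_0\to L^p(\Omega,\mathcal{F},P)$, $F(y)(\omega):=f(y,\xi(\omega))$, is continuous. Suppose that for each $\bar y\in Y_0$ there exist a neighborhood $\mathcal{Y}_{\bar y}\subset Y_0$ of $\bar y$ and a random variable $h\in L^p(\Xi,\mathcal{A},\mathbb{P})$ such that $f(y,\cdot)\ge h(\cdot)$ for all $y\in\mathcal{Y}_{\bar y}$. Let $\mathcal{R}:L^p(\Omega,\mathcal{F},P)\to\mathbb{R}$ be a convex, law invariant risk measure. Let $m^*$ and $\mathscr{S}$ be the optimal value and the solution set of $$\min_{z\in Z_{\rm ad}}\ \mathcal{R}[F(\mathbf{B}z)]+\wp(z),$$ and, for $N\in\mathbb{N}$ and $r\ge 0$, let $\hat m_N^*$ and $\hat{\mathscr{S}}_N^{r}$ be the optimal value and the set of $r$-minimizers of the empirical problem $$\min_{z\in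 Z_{\rm ad}}\ \mathcal{R}[\hat H_{\mathbf{B}z,N}]+\wp(z).$$ If $(r_N)\subset[0,\infty)$ is a deterministic sequence with $r_N\to0$ as $N\to\infty$, then $\hat m_N^*\to m^*$ with probability one (with respect to $P'$) as $N\to\infty$. If furthermore $\wp$ is an R-function, then $\mathbb{D}(\hat{\mathscr{S}}_N^{r_N},\mathscr{S})\to0$ with probability one (with respect to $P'$) as $N\to\infty$.
   Context: Standing setting: $\Xi$ is a complete separable metric space, $\mathcal{A}$ its Borel $\sigma$-algebra, $\mathbb{P}$ a probability measure on $\mathcal{A}$, and $(\Xi,\mathcal{A},\mathbb{P})$ is assumed to be a complete probability space. $f:Y_0\times\Xi\to\mathbb{R}$ is Carathéodory if $f(y,\cdot)$ is measurable for all $y$ and $f(\cdot,\xi)$ is continuous for all $\xi$. $\mathbf{B}$ is completely continuous if $z_k\rightharpoonup z$ (weakly) implies $\mathbf{B}z_k\to\mathbf{B}z$ (in norm). A functional $\rho:L^p(\Omega,\mathcal{F},P)\to\mathbb{R}$ is a convex risk measure if it is convex, monotone ($X\le Y$ a.s. implies $\rho(X)\le\rho(Y)$), and translation equivariant ($\rho(X+c)=\rho(X)+c$ for $c\in\mathbb{R}$). It is law invariant if $\rho(X_1)=\rho(X_2)$ whenever $P(X_1\le t)=P(X_2\le t)$ for all $t\in\mathbb{R}$. For a distribution function $H$ on $\mathbb{R}$, its quantile function is $H^{-1}(t):=\inf\{s\in\mathbb{R}:H(s)\ge t\}$, $t\in(0,1)$. As $(\Omega,\mathcal{F},P)$ is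 nonatomic, there is a random variable $G:\Omega\to[0,1]$ with the uniform distribution on $[0,1]$. For law invariant $\rho$ and a distribution function $H$ with $\int_0^1|H^{-1}(q)|^p\,dq<\infty$, one writes $\rho(H):=\rho(H^{-1}(G(\cdot)))$. Sampling: $\xi^1,\xi^2,\ldots$ are independent identically distributed $\Xi$-valued random elements, each with law $\mathbb{P}$, defined on a complete probability space $(\Omega',\mathcal{F}',P')$. For $y\in Y_0$, $N\in\mathbb{N}$, $\omega'\in\Omega'$, $\hat H_{y,N}(t;\omega'):=\frac1N\sum_{i=1}^N\mathbf{1}_{(-\infty,t]}(f(y,\xi^i(\omega')))$ is the empirical distribution function; the argument $\omega'$ is often omitted. Thus $\mathcal{R}[\hat H_{y,N}]=\mathcal{R}[\hat H_{y,N}^{-1}(G(\cdot);\omega')]$, and $\hat m_N^*$, $\hat{\mathscr{S}}_N^r$ depend on $\omega'$. An $r$-minimizer of a function over $Z_{\rm ad}$ with finite infimum is a point of $Z_{\rm ad}$ whose value is at most the infimum plus $r$. A function $\varphi:V\to[0,\infty)$ on a Banach space $V$ is an R-function if it is convex and continuous and if $v_k\rightharpoonup v$ and $\varphi(v_k)\to\varphi(v)$ together imply $v_k\to v$ in norm. For subsets $\Gamma,\Psi$ of a normed space, $\mathbb{D}(\Gamma,\Psi):=\sup_{x\in\Gamma}\inf_{y\in\Psi}\|x-y\|$. *)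

theory Defs
  imports "HOL-Probability.Probability"
begin

text \<open>Banach spaces. Separability is expressed by the class \<open>second_countable_topology\<close>,
  to which it is equivalent for metric spaces.\<close>

definition reflexive_space :: "'a::real_normed_vector itself \<Rightarrow> bool" where
  "reflexive_space _ \<longleftrightarrow>
     (\<forall>\<phi> :: ('a \<Rightarrow>\<^sub>L real) \<Rightarrow>\<^sub>L real. \<exists>z::'a. \<forall>g. blinfun_apply \<phi> g = blinfun_apply g z)"

definition weakly_tendsto :: "(nat \<Rightarrow> 'a::real_normed_vector) \<Rightarrow> 'a \<Rightarrow> bool" where
  "weakly_tendsto zs z \<longleftrightarrow> (\<forall>g :: 'a \<Rightarrow>\<^sub>L real. (\<lambda>k. blinfun_apply g (zs k)) \<longlonglongrightarrow> blinfun_apply g z)"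

definition completely_continuous ::
    "('a::real_normed_vector \<Rightarrow> 'b::real_normed_vector) \<Rightarrow> bool" where
  "completely_continuous B \<longleftrightarrow> (\<forall>zs z. weakly_tendsto zs z \<longrightarrow> (\<lambda>k. B (zs k)) \<longlonglongrightarrow> B z)"

definition R_function :: "('a::real_normed_vector \<Rightarrow> real) \<Rightarrow> bool" where
  "R_function \<phi> \<longleftrightarrow> (\<forall>v. 0 \<le> \<phi> v) \<and> convex_on UNIV \<phi> \<and> continuous_on UNIV \<phi> \<and>
     (\<forall>vs v. weakly_tendsto vs v \<and> (\<lambda>k. \<phi> (vs k)) \<longlonglongrightarrow> \<phi> v \<longrightarrow> vs \<longlonglongrightarrow> v)"

text \<open>Valued in \<open>[0,\<infinity>]\<close>, so that the supremum over the empty set is \<open>0\<close> and the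
  infimum over the empty set is \<open>\<infinity>\<close>.\<close>

definition excess :: "'a::real_normed_vector set \<Rightarrow> 'a set \<Rightarrow> ennreal" where
  "excess \<Gamma> \<Psi> = (SUP x\<in>\<Gamma>. INF y\<in>\<Psi>. ennreal (norm (x - y)))"

text \<open>A probability measure on the Borel \<open>\<sigma>\<close>-algebra that is complete: its \<open>\<sigma>\<close>-algebra is
  the Borel \<open>\<sigma>\<close>-algebra completed with respect to the measure. The lemma below shows that this
  covers the case in which the Borel \<open>\<sigma>\<close>-algebra itself is already complete.\<close>

definition complete_borel_prob :: "'a::topological_space measure \<Rightarrow> bool" where
  "complete_borel_prob M \<longleftrightarrow> prob_space M \<and> complete_measure M \<and>
     (\<exists>M0. sets M0 = sets borel \<and> M = completion M0)"

lemma complete_borel_probI: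
  assumes "prob_space M" and "complete_measure M" and "sets M = sets borel"
  shows "complete_borel_prob M"
proof -
  interpret complete_measure M by fact
  have *: "sets (completion M) = sets M"
  proof
    show "sets (completion M) \<subseteq> sets M"
    proof
      fix A assume "A \<in> sets (completion M)"
      then obtain S N N' where "A = S \<union> N" "N \<subseteq> N'" "N' \<in> null_sets M" "S \<in> sets M"
        by (rule sets_completionE)
      then show "A \<in> sets M"
        using complete[of N N'] by (simp add: sets.Un)
    qed
  qed auto
  have "M = completion M"
  proof (rule measure_eqI)
    show "sets M = sets (completion M)" by (rule *[symmetric])
    show "emeasure M A = emeasure (completion M) A" if "A \<in> sets M" for A
      using that by simp
  qed
  with assms show ?thesis
    unfolding complete_borel_prob_def by (intro conjI exI[of _ M])
qed

definition nonatomic :: "'a measure \<Rightarrow> bool" where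
  "nonatomic M \<longleftrightarrow> (\<forall>A\<in>sets M. 0 < emeasure M A \<longrightarrow>
     (\<exists>B\<in>sets M. B \<subseteq> A \<and> 0 < emeasure M B \<and> emeasure M B < emeasure M A))"

text \<open>Elements of \<open>L\<^sup>p\<close> are represented by functions. Functionals on \<open>L\<^sup>p\<close> therefore have to
  respect equality almost everywhere; for convex risk measures this follows from
  monotonicity, see lemma \<open>convex_risk_measure_cong_AE\<close>.\<close>

definition Lp :: "'a measure \<Rightarrow> real \<Rightarrow> ('a \<Rightarrow> real) set" where
  "Lp M p = {X \<in> borel_measurable M. integrable M (\<lambda>\<omega>. \<bar>X \<omega>\<bar> powr p)}"

definition Lp_norm :: "'a measure \<Rightarrow> real \<Rightarrow> ('a \<Rightarrow> real) \<Rightarrow> real" where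
  "Lp_norm M p X = (LINT \<omega>|M. \<bar>X \<omega>\<bar> powr p) powr (1 / p)"

definition continuous_into_Lp ::
    "'a measure \<Rightarrow> real \<Rightarrow> 'y::topological_space set \<Rightarrow> ('y \<Rightarrow> 'a \<Rightarrow> real) \<Rightarrow> bool" where
  "continuous_into_Lp M p S F \<longleftrightarrow> (\<forall>y\<in>S. F y \<in> Lp M p) \<and>
     (\<forall>y\<in>S. ((\<lambda>x. Lp_norm M p (\<lambda>\<omega>. F x \<omega> - F y \<omega>)) \<longlongrightarrow> 0) (at y within S))"

definition caratheodory ::
    "'x measure \<Rightarrow> 'y::topological_space set \<Rightarrow> ('y \<Rightarrow> 'x \<Rightarrow> real) \<Rightarrow> bool" where
  "caratheodory M S f \<longleftrightarrow> (\<forall>y\<in>S. f y \<in> borel_measurable M) \<and>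
     (\<forall>x\<in>space M. continuous_on S (\<lambda>y. f y x))"

definition convex_risk_measure :: "'a measure \<Rightarrow> real \<Rightarrow> (('a \<Rightarrow> real) \<Rightarrow> real) \<Rightarrow> bool" where
  "convex_risk_measure M p \<rho> \<longleftrightarrow>
     (\<forall>X\<in>Lp M p. \<forall>Y\<in>Lp M p. \<forall>c\<in>{0..1}.
        \<rho> (\<lambda>\<omega>. c * X \<omega> + (1 - c) * Y \<omega>) \<le> c * \<rho> X + (1 - c) * \<rho> Y) \<and>
     (\<forall>X\<in>Lp M p. \<forall>Y\<in>Lp M p. (AE \<omega> in M. X \<omega> \<le> Y \<omega>) \<longrightarrow> \<rho> X \<le> \<rho> Y) \<and>
     (\<forall>X\<in>Lp M p. \<forall>c. \<rho> (\<lambda>\<omega>. X \<omega> + c) = \<rho> X + c)"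

lemma convex_risk_measure_cong_AE:
  assumes "convex_risk_measure M p \<rho>" and "X \<in> Lp M p" and "Y \<in> Lp M p"
    and "AE \<omega> in M. X \<omega> = Y \<omega>"
  shows "\<rho> X = \<rho> Y"
proof (rule antisym)
  have mono: "\<rho> U \<le> \<rho> V"
    if "U \<in> Lp M p" "V \<in> Lp M p" "AE \<omega> in M. U \<omega> \<le> V \<omega>" for U V
    using assms(1) that by (simp add: convex_risk_measure_def)
  show "\<rho> X \<le> \<rho> Y"
    by (rule mono[OF assms(2,3)]) (rule eventually_mono[OF assms(4)], simp)
  show "\<rho> Y \<le> \<rho> X"
    by (rule mono[OF assms(3,2)]) (rule eventually_mono[OF assms(4)], simp)
qed

definition law_invariant :: "'a measure \<Rightarrow> real \<Rightarrow> (('a \<Rightarrow> real) \<Rightarrow> real) \<Rightarrow> bool" where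
  "law_invariant M p \<rho> \<longleftrightarrow> (\<forall>X\<in>Lp M p. \<forall>Y\<in>Lp M p.
     (\<forall>t. measure M {\<omega> \<in> space M. X \<omega> \<le> t} = measure M {\<omega> \<in> space M. Y \<omega> \<le> t})
       \<longrightarrow> \<rho> X = \<rho> Y)"

text \<open>Only meaningful for \<open>0 < t < 1\<close>; other arguments occur below with probability zero.\<close>

definition quantile :: "(real \<Rightarrow> real) \<Rightarrow> real \<Rightarrow> real" where
  "quantile H t = Inf {s. t \<le> H s}"

definition uniform01 :: "'a measure \<Rightarrow> ('a \<Rightarrow> real) \<Rightarrow> bool" where
  "uniform01 M G \<longleftrightarrow> G \<in> borel_measurable M \<and> G \<in> space M \<rightarrow> {0..1} \<and>
     distr M lborel G = uniform_measure lborel {0..1}"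

text \<open>The value \<open>\<rho>(H)\<close> of a law invariant functional at a distribution function \<open>H\<close>, with
  the uniform random variable \<open>G\<close> made explicit.\<close>

definition risk_of_cdf ::
    "(('a \<Rightarrow> real) \<Rightarrow> real) \<Rightarrow> ('a \<Rightarrow> real) \<Rightarrow> (real \<Rightarrow> real) \<Rightarrow> real" where
  "risk_of_cdf \<rho> G H = \<rho> (\<lambda>\<omega>. quantile H (G \<omega>))"

definition empirical_cdf :: "(nat \<Rightarrow> real) \<Rightarrow> nat \<Rightarrow> real \<Rightarrow> real" where
  "empirical_cdf v N t = (1 / real N) * (\<Sum>i=1..N. indicator {..t} (v i))"

text \<open>Extended real values, so that the infimum is meaningful without assuming boundedness.\<close>

definition optimal_value :: "'z set \<Rightarrow> ('z \<Rightarrow> real) \<Rightarrow> ereal" where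
  "optimal_value S J = (INF z\<in>S. ereal (J z))"

definition approx_minimizers :: "'z set \<Rightarrow> ('z \<Rightarrow> real) \<Rightarrow> real \<Rightarrow> 'z set" where
  "approx_minimizers S J r = {z\<in>S. ereal (J z) \<le> optimal_value S J + ereal r}"

definition solution_set :: "'z set \<Rightarrow> ('z \<Rightarrow> real) \<Rightarrow> 'z set" where
  "solution_set S J = {z\<in>S. \<forall>z'\<in>S. J z \<le> J z'}"

definition true_objective ::
    "(('w \<Rightarrow> real) \<Rightarrow> real) \<Rightarrow> ('y \<Rightarrow> 'x \<Rightarrow> real) \<Rightarrow> ('w \<Rightarrow> 'x) \<Rightarrow> ('z \<Rightarrow> 'y) \<Rightarrow> ('z \<Rightarrow> real) \<Rightarrow> 'z \<Rightarrow> real"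
  where "true_objective \<rho> f \<xi> B \<psi> z = \<rho> (\<lambda>\<omega>. f (B z) (\<xi> \<omega>)) + \<psi> z"

text \<open>The argument \<open>x\<close> is a realization \<open>i \<mapsto> \<xi>\<^sup>i(\<omega>')\<close> of the sample, indexed from \<open>1\<close>.\<close>

definition empirical_objective ::
    "(('w \<Rightarrow> real) \<Rightarrow> real) \<Rightarrow> ('w \<Rightarrow> real) \<Rightarrow> ('y \<Rightarrow> 'x \<Rightarrow> real) \<Rightarrow> (nat \<Rightarrow> 'x) \<Rightarrow>
      ('z \<Rightarrow> 'y) \<Rightarrow> ('z \<Rightarrow> real) \<Rightarrow> nat \<Rightarrow> 'z \<Rightarrow> real"
  where "empirical_objective \<rho> G f x B \<psi> N z =
    risk_of_cdf \<rho> G (empirical_cdf (\<lambda>i. f (B z) (x i)) N) + \<psi> z"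

end

(* For an i.i.d. sample the empirical distribution of a p-integrable g converges almost surely to the
   law of g at all rational points and in its p-th absolute moment, by the strong law of large numbers
   (truncation, Hoeffding's inequality, and Garsia's maximal inequality for the tails). Hence its
   quantile functions, evaluated at G, converge in L^p. A finite convex monotone functional on L^p is
   continuous, so the empirical risk of g converges to the true risk; this uses law invariance.

   For an upper bound on the empirical optimal value this is applied to one minimizer. For a lower
   bound it is applied to the infima of f over small balls around countably many centres: by
   monotonicity their empirical risks bound from below the empirical risks of all points of the ball,
   which gives a lower limit that is locally uniform in y. Bounded sequences in Z have weakly convergent
   subsequences, B turns weak into norm convergence, and psi is weakly lower semicontinuous; along
   near-minimizers psi converges as well, which for R-functions upgrades weak to norm convergence. *)
theory Submission
  imports Defs
begin

section \<open>Weak convergence in reflexive spaces\<close>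

text \<open>Two obstacles shape the proof. The strong law gives one null set per integrand, while
  the minimization ranges over uncountably many \<open>y\<close>; so only countably many envelopes,
  one for each centre and each tolerance \<open>1 / (j + 1)\<close>, are ever sampled. And
  \<open>f\<close> has local minorants only, so the uniform control is one-sided: a locally uniform
  lower limit everywhere, and convergence at a single minimizer that is fixed before sampling. This
  pair of facts is all that the minimization argument needs. The true and the empirical laws live on
  different probability spaces. Evaluating their quantile functions at the same \<open>G\<close>
  puts them on \<open>P\<close>, where convergence of distribution functions becomes convergence
  almost everywhere and convergence of moments improves it to \<open>L^p\<close>. Once a sample
  outside the null set is fixed, nothing random is left, and the convergence of values and
  near-minimizers is a deterministic statement proved in a locale.\<close>

definition sublinear :: "('a::real_vector \<Rightarrow> real) \<Rightarrow> bool" where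
  "sublinear p \<longleftrightarrow> (\<forall>x y. p (x + y) \<le> p x + p y) \<and> (\<forall>t x. 0 \<le> t \<longrightarrow> p (t *\<^sub>R x) = t * p x)"

lemma sublinear_add: "sublinear p \<Longrightarrow> p (x + y) \<le> p x + p y"
  and sublinear_scale: "sublinear p \<Longrightarrow> 0 \<le> t \<Longrightarrow> p (t *\<^sub>R x) = t * p x"
  by (auto simp: sublinear_def)

lemma sublinear_0: "sublinear p \<Longrightarrow> p 0 = 0"
  using sublinear_scale[of p 0 0] by simp

lemma sublinear_minus: "sublinear p \<Longrightarrow> - p (- x) \<le> p x"
  using sublinear_add[of p x "- x"] sublinear_0[of p] by simp

lemma sublinear_norm: "sublinear norm"
  by (simp add: sublinear_def norm_triangle_ineq)

text \<open>Applied to the norm this separates \<open>C\<close> from \<open>0\<close>; applied to \<open>C = {x}\<close> and \<open>\<delta> = p x\<close> it shows that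
  minimal sublinear functionals are linear, so that no extension from subspaces is needed.\<close>

lemma sublinear_pushdown:
  fixes p :: "'a::real_vector \<Rightarrow> real"
  assumes p: "sublinear p" and C: "convex C" "C \<noteq> {}" and \<delta>: "\<And>c. c \<in> C \<Longrightarrow> \<delta> \<le> p c"
  shows "\<exists>q. sublinear q \<and> (\<forall>v. q v \<le> p v) \<and> (\<forall>c\<in>C. q (- c) \<le> - \<delta>)"
proof -
  \<comment> \<open>\<open>q\<close> is the largest sublinear functional below \<open>p\<close> with
    \<open>q (- c) \<le> - \<delta>\<close> on \<open>C\<close>: any such \<open>q'\<close>
    satisfies \<open>q' v \<le> q' (v + t c) + t * q' (- c) \<le> p (v + t c) - t *
    \<delta>\<close>.\<close>
  define S where "S v = {p (v + t *\<^sub>R c) - t * \<delta> |t c. 0 \<le> t \<and> c \<in> C}" for v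
  define q where "q v = Inf (S v)" for v
  obtain c0 where c0: "c0 \<in> C" using C by auto
  have S_I: "p (v + t *\<^sub>R c) - t * \<delta> \<in> S v" if "0 \<le> t" "c \<in> C" for v t c
    using that by (auto simp: S_def)
  have ne: "S v \<noteq> {}" for v
    using S_I[of 0 c0 v] c0 by auto
  \<comment> \<open>Here \<open>\<delta> \<le> p c\<close> keeps the infimum finite.\<close>
  have lb: "- p (- v) \<le> s" if s: "s \<in> S v" for s v
  proof -
    obtain t c where tc: "0 \<le> t" "c \<in> C" "s = p (v + t *\<^sub>R c) - t * \<delta>"
      using s by (auto simp: S_def)
    have "t * \<delta> \<le> t * p c"
      using \<delta> tc by (intro mult_left_mono) auto
    also have "\<dots> = p (t *\<^sub>R c)"
      using sublinear_scale[OF p tc(1)] by simp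
    also have "\<dots> \<le> p (v + t *\<^sub>R c) + p (- v)"
      using sublinear_add[OF p, of "v + t *\<^sub>R c" "- v"] by simp
    finally show ?thesis using tc by simp
  qed
  have bdd: "bdd_below (S v)" for v
    using lb unfolding bdd_below_def by blast
  have q_le: "q v \<le> s" if "s \<in> S v" for s v
    unfolding q_def using bdd that by (rule cInf_lower[rotated])
  have le_q: "a \<le> q v" if "\<And>s. s \<in> S v \<Longrightarrow> a \<le> s" for a v
    unfolding q_def using ne that by (rule cInf_greatest)
  have qp: "q v \<le> p v" for v
    using q_le[OF S_I[of 0 c0 v]] c0 by simp
  have add: "q (v + w) \<le> q v + q w" for v w
  proof -
    have "q (v + w) - s2 \<le> q v" if s2: "s2 \<in> S w" for s2
    proof (rule le_q)
      fix s1 assume s1: "s1 \<in> S v"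
      obtain t c where tc: "0 \<le> t" "c \<in> C" "s1 = p (v + t *\<^sub>R c) - t * \<delta>"
        using s1 by (auto simp: S_def)
      obtain t' c' where tc': "0 \<le> t'" "c' \<in> C" "s2 = p (w + t' *\<^sub>R c') - t' * \<delta>"
        using s2 by (auto simp: S_def)
      \<comment> \<open>Subadditivity needs the two rays merged into one; the weighted mean of
        \<open>c\<close> and \<open>c'\<close> lies in \<open>C\<close> by convexity.\<close>
      have "\<exists>d\<in>C. t *\<^sub>R c + t' *\<^sub>R c' = (t + t') *\<^sub>R d"
      proof (cases "t + t' = 0")
        case True
        then have "t = 0" "t' = 0" using tc tc' by auto
        then show ?thesis using c0 by auto
      next
        case False
        define d where "d = (t / (t + t')) *\<^sub>R c + (t' / (t + t')) *\<^sub>R c'"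
        have "d \<in> C"
          unfolding d_def using False tc tc' C
          by (intro convexD) (auto simp: add_divide_distrib[symmetric])
        moreover have "t *\<^sub>R c + t' *\<^sub>R c' = (t + t') *\<^sub>R d"
          using False by (simp add: d_def scaleR_add_right)
        ultimately show ?thesis by blast
      qed
      then obtain d where d: "d \<in> C" "t *\<^sub>R c + t' *\<^sub>R c' = (t + t') *\<^sub>R d" by blast
      have "q (v + w) \<le> p (v + w + (t + t') *\<^sub>R d) - (t + t') * \<delta>"
        using tc tc' d by (intro q_le S_I) auto
      also have "v + w + (t + t') *\<^sub>R d = (v + t *\<^sub>R c) + (w + t' *\<^sub>R c')"
        using d(2) by (simp add: algebra_simps)
      also have "p \<dots> - (t + t') * \<delta> \<le> s1 + s2"
        using sublinear_add[OF p, of "v + t *\<^sub>R c" "w + t' *\<^sub>R c'"] tc tc'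
        by (simp add: algebra_simps)
      finally show "q (v + w) - s2 \<le> s1" by simp
    qed
    then have "q (v + w) - q v \<le> s2" if "s2 \<in> S w" for s2
      using that by fastforce
    then have "q (v + w) - q v \<le> q w" by (rule le_q)
    then show ?thesis by simp
  qed
  have scale_le: "q (t *\<^sub>R v) \<le> t * q v" if t: "0 < t" for t v
  proof -
    have "q (t *\<^sub>R v) / t \<le> q v"
    proof (rule le_q)
      fix s assume "s \<in> S v"
      then obtain u c where uc: "0 \<le> u" "c \<in> C" "s = p (v + u *\<^sub>R c) - u * \<delta>"
        by (auto simp: S_def)
      have "q (t *\<^sub>R v) \<le> p (t *\<^sub>R v + (t * u) *\<^sub>R c) - (t * u) * \<delta>"
        using uc t by (intro q_le S_I) auto
      also have "t *\<^sub>R v + (t * u) *\<^sub>R c = t *\<^sub>R (v + u *\<^sub>R c)"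
        by (simp add: algebra_simps)
      also have "p \<dots> - (t * u) * \<delta> = t * s"
        using t sublinear_scale[OF p, of t "v + u *\<^sub>R c"] unfolding uc(3)
          by (simp add: right_diff_distrib)
      finally show "q (t *\<^sub>R v) / t \<le> s" using t by (simp add: field_simps)
    qed
    then show ?thesis using t by (simp add: field_simps)
  qed
  have q0: "q 0 = 0"
    using qp[of 0] le_q[of 0 0] lb[of _ 0] sublinear_0[OF p] by force
  have "q (t *\<^sub>R v) = t * q v" if t: "0 \<le> t" for t v
  proof (cases "t = 0")
    case False
    then have t: "0 < t" using t by simp
    have "q v \<le> inverse t * q (t *\<^sub>R v)"
      using scale_le[of "inverse t" "t *\<^sub>R v"] t by simp
    then have "t * q v \<le> q (t *\<^sub>R v)"
      using t by (simp add: field_simps)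
    then show ?thesis using scale_le[OF t, of v] by simp
  qed (simp add: q0)
  then have "sublinear q" using add by (simp add: sublinear_def)
  moreover have "q (- c) \<le> - \<delta>" if "c \<in> C" for c
    using q_le[OF S_I[of 1 c "- c"]] that sublinear_0[OF p] by simp
  ultimately show ?thesis using qp by blast
qed

text \<open>Zorn's lemma gives a minimal sublinear functional below \<open>p\<close>. Minimal ones
  are odd, since otherwise they could be pushed down further, and an odd sublinear functional is
  linear.\<close>

lemma exists_linear_below_sublinear:
  fixes p :: "'a::real_vector \<Rightarrow> real"
  assumes p: "sublinear p"
  shows "\<exists>g. linear g \<and> (\<forall>v. g v \<le> p v)"
proof -
  define A where "A = {q :: 'a \<Rightarrow> real. sublinear q \<and> (\<forall>v. q v \<le> p v)}"
  \<comment> \<open>The order is reversed, so that the maximal elements of Zorn's lemma are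
    pointwise minimal.\<close>
  define R where "R = (\<lambda>a b :: 'a \<Rightarrow> real. \<forall>v. b v \<le> a v)"
  have "partial_order_on A (relation_of R A)"
    unfolding partial_order_on_def preorder_on_def refl_on_def trans_def antisym_def
      relation_of_def R_def
    by (auto intro: order_trans intro!: ext antisym)
  moreover have "\<exists>u\<in>A. \<forall>a\<in>Ch. R a u" if Ch: "Ch \<in> Chains (relation_of R A)" for Ch
  proof (cases "Ch = {}")
    case True
    have "p \<in> A" using p by (simp add: A_def)
    then show ?thesis using True by blast
  next
    case False
    have ChA: "a \<in> A" if "a \<in> Ch" for a
      using Ch that by (auto simp: Chains_def relation_of_def)
    have tot: "(\<forall>v. a v \<le> b v) \<or> (\<forall>v. b v \<le> a v)" if "a \<in> Ch" "b \<in> Ch" for a b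
      using Ch that by (auto simp: Chains_def relation_of_def R_def)
    define u where "u v = (INF a\<in>Ch. a v)" for v
    have lb: "- p (- v) \<le> a v" if "a \<in> Ch" for a v
    proof -
      have "- p (- v) \<le> - a (- v)" using ChA[OF that] by (simp add: A_def)
      also have "\<dots> \<le> a v" using ChA[OF that] sublinear_minus[of a v] by (simp add: A_def)
      finally show ?thesis .
    qed
    have bdd: "bdd_below ((\<lambda>a. a v) ` Ch)" for v
      using lb unfolding bdd_below_def by auto
    have u_le: "u v \<le> a v" if "a \<in> Ch" for a v
      unfolding u_def using bdd that by (rule cINF_lower)
    have le_u: "x \<le> u v" if "\<And>a. a \<in> Ch \<Longrightarrow> x \<le> a v" for x v
      unfolding u_def using False that by (rule cINF_greatest)
    have add: "u (x + y) \<le> u x + u y" for x y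
    proof -
      \<comment> \<open>Elements of a chain are comparable, so one \<open>m\<close> lies below both
        \<open>a\<close> and \<open>b\<close>, and its subadditivity passes to the infimum.\<close>
      have "u (x + y) - b y \<le> u x" if b: "b \<in> Ch" for b
      proof (rule le_u)
        fix a assume a: "a \<in> Ch"
        obtain m where m: "m \<in> Ch" "\<forall>v. m v \<le> a v" "\<forall>v. m v \<le> b v"
          using tot[OF a b] a b by blast
        have "u (x + y) \<le> m (x + y)" using m by (intro u_le)
        also have "\<dots> \<le> m x + m y" using ChA[OF m(1)] by (simp add: A_def sublinear_def)
        also have "\<dots> \<le> a x + b y" using m by (intro add_mono) auto
        finally show "u (x + y) - b y \<le> a x" by simp
      qed
      then have "u (x + y) - u x \<le> u y" by (intro le_u) fastforce
      then show ?thesis by simp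
    qed
    have scale: "u (t *\<^sub>R x) = t * u x" if t: "0 \<le> t" for t x
    proof -
      have eq: "a (t *\<^sub>R x) = t * a x" if "a \<in> Ch" for a
        using ChA[OF that] t by (simp add: A_def sublinear_def)
      show ?thesis
      proof (cases "t = 0")
        case True
        then have "(\<lambda>a. a (t *\<^sub>R x)) ` Ch = {0}" using False eq by force
        then show ?thesis using True by (simp add: u_def)
      next
        case nz: False
        then have t: "0 < t" using t by simp
        have "u (t *\<^sub>R x) / t \<le> u x"
          using u_le[of _ "t *\<^sub>R x"] eq t by (intro le_u) (simp add: field_simps)
        moreover have "t * u x \<le> u (t *\<^sub>R x)"
        proof (rule le_u)
          fix a assume a: "a \<in> Ch"
          show "t * u x \<le> a (t *\<^sub>R x)"
            using mult_left_mono[OF u_le[OF a, of x], of t] eq[OF a] t by simp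
        qed
        ultimately show ?thesis using t by (simp add: field_simps)
      qed
    qed
    have "u v \<le> p v" for v
      using False u_le ChA by (fastforce simp: A_def intro: order_trans)
    then have "u \<in> A" using add scale by (simp add: A_def sublinear_def)
    then show ?thesis using u_le by (auto simp: R_def)
  qed
  ultimately obtain g where g: "g \<in> A" and min: "\<And>a. a \<in> A \<Longrightarrow> R g a \<Longrightarrow> a = g"
    using predicate_Zorn[of A R] by blast
  have sg: "sublinear g" and gp: "\<And>v. g v \<le> p v" using g by (auto simp: A_def)
  have neg: "g (- x) = - g x" for x
  proof -
    obtain q where q: "sublinear q" "\<And>v. q v \<le> g v" "q (- x) \<le> - g x"
      using sublinear_pushdown[OF sg, of "{x}" "g x"] by auto
    have "q \<in> A" using q gp by (auto simp: A_def intro: order_trans)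
    then have "q = g" using min q by (auto simp: R_def)
    then show ?thesis using q(3) sublinear_minus[OF sg, of x] by simp
  qed
  have "linear g"
  proof (rule linearI)
    fix x y
    have "- g (x + y) \<le> - g x + - g y"
      using sublinear_add[OF sg, of "- x" "- y"] neg[of "x + y"] neg[of x] neg[of y] by simp
    then show "g (x + y) = g x + g y" using sublinear_add[OF sg, of x y] by simp
  next
    fix r x
    show "g (r *\<^sub>R x) = r *\<^sub>R g x"
    proof (cases "0 \<le> r")
      case False
      then show ?thesis using sublinear_scale[OF sg, of "- r" x] neg[of "r *\<^sub>R x"] by simp
    qed (simp add: sublinear_scale[OF sg])
  qed
  then show ?thesis using gp by blast
qed

text \<open>A linear functional below the pushed-down norm inherits both bounds: being below the
  norm gives operator norm at most 1, and \<open>g (- c) \<le> - \<delta>\<close> is the bound on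
  \<open>C\<close>.\<close>

lemma exists_functional_ge_on_convex:
  fixes C :: "'a::real_normed_vector set"
  assumes "convex C" "C \<noteq> {}" "\<And>c. c \<in> C \<Longrightarrow> \<delta> \<le> norm c"
  shows "\<exists>g :: 'a \<Rightarrow>\<^sub>L real. norm g \<le> 1 \<and> (\<forall>c\<in>C. \<delta> \<le> blinfun_apply g c)"
proof -
  obtain q where q: "sublinear q" "\<And>v::'a. q v \<le> norm v" "\<And>c. c \<in> C \<Longrightarrow> q (- c) \<le> - \<delta>"
    using sublinear_pushdown[OF sublinear_norm assms] by blast
  obtain g where g: "linear g" "\<And>v. g v \<le> q v"
    using exists_linear_below_sublinear[OF q(1)] by blast
  have le: "g v \<le> norm v" for v using g(2)[of v] q(2)[of v] by linarith
  have abs: "norm (g v) \<le> norm v * 1" for v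
    using le[of v] le[of "- v"] linear_neg[OF g(1), of v] by simp
  have bl: "bounded_linear g"
    using g(1) abs by (intro bounded_linear_intro[of g 1]) (auto simp: linear_add linear_scale)
  have "norm (Blinfun g) \<le> 1"
    using abs by (intro norm_blinfun_bound) (auto simp: bounded_linear_Blinfun_apply[OF bl])
  moreover have "\<delta> \<le> blinfun_apply (Blinfun g) c" if "c \<in> C" for c
    using g(2)[of "- c"] q(3)[OF that] linear_neg[OF g(1), of c]
    by (simp add: bounded_linear_Blinfun_apply[OF bl])
  ultimately show ?thesis by blast
qed

lemma exists_norming_functional:
  fixes x :: "'a::real_normed_vector"
  shows "\<exists>g :: 'a \<Rightarrow>\<^sub>L real. norm g \<le> 1 \<and> norm x \<le> blinfun_apply g x"
  using exists_functional_ge_on_convex[of "{x}" "norm x"] by auto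

text \<open>After translating \<open>x\<close> to the origin, the radius of a ball around
  \<open>x\<close> that misses \<open>C\<close> bounds the norm from below on the translated
  set.\<close>

lemma exists_separating_functional:
  fixes C :: "'a::real_normed_vector set"
  assumes "closed C" "convex C" "C \<noteq> {}" "x \<notin> C"
  shows "\<exists>g :: 'a \<Rightarrow>\<^sub>L real. \<exists>\<delta>>0. \<forall>c\<in>C. blinfun_apply g x + \<delta> \<le> blinfun_apply g c"
proof -
  obtain \<delta> where \<delta>: "0 < \<delta>" "\<And>c. c \<in> C \<Longrightarrow> \<delta> \<le> dist x c"
  proof -
    have "open (- C)" "x \<in> - C" using assms by (auto simp: open_Compl)
    then obtain \<delta> where "0 < \<delta>" "ball x \<delta> \<subseteq> - C" by (rule openE)
    then show ?thesis by (intro that[of \<delta>]) (auto simp: subset_eq not_le intro: leI)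
  qed
  have "convex ((\<lambda>c. c - x) ` C)"
    using assms(2) by (simp add: convex_translation_subtract)
  then obtain g :: "'a \<Rightarrow>\<^sub>L real" where "\<forall>c\<in>(\<lambda>c. c - x) ` C. \<delta> \<le> blinfun_apply g c"
    using exists_functional_ge_on_convex[of "(\<lambda>c. c - x) ` C" \<delta>] assms(3) \<delta>(2)
    by (force simp: dist_norm norm_minus_commute)
  then have "\<forall>c\<in>C. blinfun_apply g x + \<delta> \<le> blinfun_apply g c"
    by (simp add: blinfun.diff_right algebra_simps)
  then show ?thesis using \<delta>(1) by blast
qed

section \<open>Weak sequential limits and weak compactness of bounded sequences\<close>

lemma weakly_tendsto_subseq:
  "weakly_tendsto zs z \<Longrightarrow> strict_mono s \<Longrightarrow> weakly_tendsto (zs \<circ> s) z"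
  unfolding weakly_tendsto_def comp_def by (auto intro: LIMSEQ_subseq_LIMSEQ[unfolded comp_def])

text \<open>Mazur's theorem for sequences: a functional separating \<open>z\<close> from
  \<open>C\<close> would keep a fixed gap along the whole sequence.\<close>

lemma weakly_tendsto_closed_convex:
  fixes C :: "'a::real_normed_vector set"
  assumes "closed C" "convex C" "\<And>n. zs n \<in> C" "weakly_tendsto zs z"
  shows "z \<in> C"
proof (rule ccontr)
  assume "z \<notin> C"
  moreover have "C \<noteq> {}" using assms(3) by blast
  ultimately obtain g :: "'a \<Rightarrow>\<^sub>L real" and \<delta> where g: "0 < \<delta>" "\<forall>c\<in>C. blinfun_apply g z + \<delta> \<le> blinfun_apply g c"
    using exists_separating_functional[OF assms(1,2)] by blast
  have "(\<lambda>k. blinfun_apply g (zs k)) \<longlonglongrightarrow> blinfun_apply g z"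
    using assms(4) by (simp add: weakly_tendsto_def)
  moreover have "blinfun_apply g z + \<delta> \<le> blinfun_apply g (zs k)" for k
    using g assms(3) by blast
  ultimately have "blinfun_apply g z + \<delta> \<le> blinfun_apply g z"
    using LIMSEQ_le_const by blast
  then show False using g by simp
qed

lemma frequently_subseq:
  assumes "\<exists>\<^sub>F n in sequentially. Q n"
  shows "\<exists>s :: nat \<Rightarrow> nat. strict_mono s \<and> (\<forall>n. Q (s n))"
proof -
  have "infinite {n. Q n}"
    using assms by (simp add: frequently_cofinite[symmetric] cofinite_eq_sequentially)
  then show ?thesis
    using strict_mono_enumerate[of "{n. Q n}"] enumerate_in_set[of "{n. Q n}"] by blast
qed

text \<open>Sublevel sets are closed and convex, hence weakly sequentially closed. If the claim
  failed, a subsequence would stay in one of them and so would \<open>z\<close>.\<close>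

lemma convex_weakly_lsc:
  fixes \<psi> :: "'a::real_normed_vector \<Rightarrow> real"
  assumes "convex_on UNIV \<psi>" "continuous_on UNIV \<psi>" "weakly_tendsto zs z" "c < \<psi> z"
  shows "\<forall>\<^sub>F n in sequentially. c < \<psi> (zs n)"
proof (rule ccontr)
  assume "\<not> (\<forall>\<^sub>F n in sequentially. c < \<psi> (zs n))"
  then obtain s :: "nat \<Rightarrow> nat" where s: "strict_mono s" "\<And>n. \<psi> (zs (s n)) \<le> c"
    using frequently_subseq[of "\<lambda>n. \<psi> (zs n) \<le> c"]
    unfolding not_eventually not_less by blast
  have "closed {v. \<psi> v \<le> c}"
    using assms(2) by (intro closed_Collect_le) auto
  moreover have "convex {v. \<psi> v \<le> c}"
    unfolding convex_alt
  proof clarify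
    fix x y and u :: real
    assume *: "\<psi> x \<le> c" "\<psi> y \<le> c" "0 \<le> u" "u \<le> 1"
    have "\<psi> ((1 - u) *\<^sub>R x + u *\<^sub>R y) \<le> (1 - u) * \<psi> x + u * \<psi> y"
      using assms(1) * by (intro convex_onD) auto
    also have "\<dots> \<le> (1 - u) * c + u * c"
      using * by (intro add_mono mult_left_mono) auto
    finally show "\<psi> ((1 - u) *\<^sub>R x + u *\<^sub>R y) \<le> c" by (simp add: algebra_simps)
  qed
  ultimately have "z \<in> {v. \<psi> v \<le> c}"
    by (rule weakly_tendsto_closed_convex[where zs = "zs \<circ> s"])
       (use s assms(3) in \<open>auto intro: weakly_tendsto_subseq\<close>)
  then show False using assms(4) by simp
qed

text \<open>Separability of the dual, in the form that diagonal extraction uses. The witnesses are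
  norming functionals of a countable dense set. A functional on the dual that vanishes on all of
  them is evaluation at some \<open>z\<close> by reflexivity, and density forces
  \<open>z = 0\<close>.\<close>

lemma reflexive_dual_dense_span:
  assumes "reflexive_space TYPE('z::{banach, second_countable_topology})"
  shows "\<exists>d :: nat \<Rightarrow> 'z \<Rightarrow>\<^sub>L real. closure (span (range d)) = UNIV"
proof -
  obtain E :: "'z set" where E: "countable E" "\<And>X. open X \<Longrightarrow> X \<noteq> {} \<Longrightarrow> \<exists>e\<in>E. e \<in> X"
    using countable_dense_exists by metis
  have Ene: "E \<noteq> {}" using E(2)[of UNIV] by auto
  obtain n :: "'z \<Rightarrow> 'z \<Rightarrow>\<^sub>L real" where n: "\<And>e. norm (n e) \<le> 1" "\<And>e. norm e \<le> blinfun_apply (n e) e"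
    using exists_norming_functional by metis
  define d where "d j = n (from_nat_into E j)" for j
  have nd: "n e \<in> range d" if "e \<in> E" for e
    using from_nat_into_surj[OF E(1) that] by (auto simp: d_def)
  have "g \<in> closure (span (range d))" for g
  proof (rule ccontr)
    assume g: "g \<notin> closure (span (range d))"
    have "convex (closure (span (range d)))"
      by (intro convex_closure subspace_imp_convex) auto
    moreover have "closure (span (range d)) \<noteq> {}" using span_zero[of "range d"] by auto
    ultimately obtain \<Phi> :: "('z \<Rightarrow>\<^sub>L real) \<Rightarrow>\<^sub>L real" and \<delta>
      where \<Phi>: "0 < \<delta>" "\<And>c. c \<in> closure (span (range d)) \<Longrightarrow> blinfun_apply \<Phi> g + \<delta> \<le> blinfun_apply \<Phi> c"
      using exists_separating_functional[OF closed_closure _ _ g] by metis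
    \<comment> \<open>A functional bounded below on a subspace vanishes there; the scaling factor is
      chosen so that the multiple of \<open>c\<close> gets exactly the value of
      \<open>\<Phi>\<close> at \<open>g\<close>, which the gap \<open>\<delta>\<close>
      forbids.\<close>
    have zero: "blinfun_apply \<Phi> c = 0" if c: "c \<in> span (range d)" for c
    proof (rule ccontr)
      assume nz: "blinfun_apply \<Phi> c \<noteq> 0"
      have "(blinfun_apply \<Phi> g / blinfun_apply \<Phi> c) *\<^sub>R c \<in> closure (span (range d))"
        using c by (auto intro: span_scale closure_subset[THEN subsetD])
      from \<Phi>(2)[OF this] show False using nz \<Phi>(1) by (simp add: blinfun.scaleR_right)
    qed
    obtain z where z: "\<And>h. blinfun_apply \<Phi> h = blinfun_apply h z"
      using assms by (auto simp: reflexive_space_def)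
    have "z \<noteq> 0"
      using \<Phi>(2)[of 0] \<Phi>(1) z span_zero[of "range d"] closure_subset[of "span (range d)"]
      by auto
    \<comment> \<open>Half the norm is the threshold: \<open>n e\<close> annihilates
      \<open>z\<close>, so \<open>norm e \<le> norm (e - z)\<close>, and two quantities below
      \<open>norm z / 2\<close> cannot add up to \<open>norm z\<close>.\<close>
    then have "ball z (norm z / 2) \<noteq> {}" by simp
    then obtain e where e: "e \<in> E" "e \<in> ball z (norm z / 2)"
      using E(2)[of "ball z (norm z / 2)"] by auto
    have "blinfun_apply (n e) z = 0" using zero[of "n e"] nd[OF e(1)] z span_base by metis
    then have "norm e \<le> blinfun_apply (n e) (e - z)" using n(2)[of e] by (simp add: blinfun.diff_right)
    also have "\<dots> \<le> norm (n e) * norm (e - z)"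
      using norm_blinfun[of "n e" "e - z"] by simp
    also have "\<dots> \<le> norm (e - z)"
      using n(1)[of e] mult_right_mono[of "norm (n e)" 1 "norm (e - z)"] by simp
    finally have "norm e \<le> norm (e - z)" .
    moreover have "norm (e - z) < norm z / 2"
      using e by (simp add: dist_norm norm_minus_commute)
    moreover have "norm z \<le> norm e + norm (e - z)"
      using norm_triangle_sub[of z e] by (simp add: norm_minus_commute)
    ultimately show False by simp
  qed
  then show ?thesis by auto
qed

text \<open>A diagonal subsequence converges on the countable family \<open>d\<close>, and by
  boundedness and density on the whole dual. The limit is a bounded functional on the dual, which
  reflexivity represents by a point.\<close>

lemma reflexive_bounded_weak_subseq:
  fixes zs :: "nat \<Rightarrow> 'z::{banach, second_countable_topology}"
  assumes refl: "reflexive_space TYPE('z)" and b: "bounded (range zs)"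
  shows "\<exists>s z. strict_mono (s :: nat \<Rightarrow> nat) \<and> weakly_tendsto (zs \<circ> s) z"
proof -
  obtain d :: "nat \<Rightarrow> 'z \<Rightarrow>\<^sub>L real" where d: "closure (span (range d)) = UNIV"
    using reflexive_dual_dense_span[OF refl] by blast
  obtain K where K: "\<And>n. norm (zs n) \<le> K" "0 < K"
    using b by (auto simp: bounded_pos)
  have bd: "norm (blinfun_apply g (zs n)) \<le> norm g * K" for g :: "'z \<Rightarrow>\<^sub>L real" and n
    by (rule order_trans[OF norm_blinfun]) (intro mult_left_mono K, simp)
  interpret subseqs "\<lambda>n s. convergent (\<lambda>k. blinfun_apply (d n) (zs (s k)))"
  proof
    fix n and s :: "nat \<Rightarrow> nat"
    have "bounded (range (\<lambda>k. blinfun_apply (d n) (zs (s k))))"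
      using bd[of "d n"] by (auto simp: bounded_iff)
    then obtain l r where "strict_mono r" "((\<lambda>k. blinfun_apply (d n) (zs (s k))) \<circ> r) \<longlonglongrightarrow> l"
      using bounded_imp_convergent_subsequence by blast
    then show "\<exists>r'. strict_mono r' \<and> convergent (\<lambda>k. blinfun_apply (d n) (zs ((s \<circ> r') k)))"
      by (auto simp: convergent_def comp_def)
  qed
  define s where "s = diagseq"
  have s: "strict_mono s" unfolding s_def by (rule subseq_diagseq)
  have conv: "convergent (\<lambda>k. blinfun_apply (d n) (zs (s k)))" for n
  proof -
    \<comment> \<open>The diagonal sequence is a subsequence of the \<open>n\<close>-th selected
      sequence only from index \<open>Suc n\<close> on; the missing initial segment does not affect
      convergence.\<close>
    have "convergent (\<lambda>k. blinfun_apply (d n) (zs ((diagseq \<circ> (+) (Suc n)) k)))"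
    proof (rule diagseq_holds)
      fix s r :: "nat \<Rightarrow> nat" and n
      assume "strict_mono r" "convergent (\<lambda>k. blinfun_apply (d n) (zs (s k)))"
      then show "convergent (\<lambda>k. blinfun_apply (d n) (zs ((s \<circ> r) k)))"
        by (auto simp: convergent_def comp_def
            intro: LIMSEQ_subseq_LIMSEQ[unfolded comp_def, of "\<lambda>k. blinfun_apply (d n) (zs (s k))"])
    qed
    then have "convergent (\<lambda>k. blinfun_apply (d n) (zs (s (k + Suc n))))" by (simp add: s_def add.commute)
    then show ?thesis
      by (subst (asm) convergent_ignore_initial_segment[of "\<lambda>k. blinfun_apply (d n) (zs (s k))" "Suc n"])
  qed
  \<comment> \<open>The functionals with Cauchy values form a subspace containing all
    \<open>d n\<close>; a three-term estimate with \<open>e / (3 * K)\<close> then extends this to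
    its closure.\<close>
  define V where "V = {g :: 'z \<Rightarrow>\<^sub>L real. Cauchy (\<lambda>k. blinfun_apply g (zs (s k)))}"
  have "subspace V"
    unfolding subspace_def V_def
    by (auto simp: blinfun.add_left blinfun.scaleR_left Cauchy_convergent_iff
        intro!: convergent_add convergent_mult convergent_const)
  moreover have "range d \<subseteq> V" using conv by (auto simp: V_def Cauchy_convergent_iff)
  ultimately have span: "span (range d) \<subseteq> V" by (intro span_minimal)
  have V: "g \<in> V" for g
    unfolding V_def mem_Collect_eq
  proof (rule metric_CauchyI)
    fix e :: real assume e: "0 < e"
    have "g \<in> closure (span (range d))" using d by simp
    then obtain h where h: "h \<in> span (range d)" "dist h g < e / (3 * K)"
      using e K by (meson closure_approachable divide_pos_pos mult_pos_pos zero_less_numeral)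
    have close: "dist (blinfun_apply g (zs (s k))) (blinfun_apply h (zs (s k))) < e / 3" for k
    proof -
      have "dist (blinfun_apply g (zs (s k))) (blinfun_apply h (zs (s k))) \<le> norm (g - h) * K"
        using bd[of "g - h" "s k"] by (simp add: dist_norm blinfun.diff_left)
      also have "\<dots> < e / (3 * K) * K"
        using h(2) K by (intro mult_strict_right_mono) (auto simp: dist_norm norm_minus_commute)
      also have "\<dots> = e / 3" using K by simp
      finally show ?thesis .
    qed
    have "Cauchy (\<lambda>k. blinfun_apply h (zs (s k)))" using h span by (auto simp: V_def)
    then obtain M where M: "\<And>m n. M \<le> m \<Longrightarrow> M \<le> n \<Longrightarrow>
        dist (blinfun_apply h (zs (s m))) (blinfun_apply h (zs (s n))) < e / 3"
      using e metric_CauchyD[of _ "e / 3"] by (metis divide_pos_pos zero_less_numeral)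
    have "dist (blinfun_apply g (zs (s m))) (blinfun_apply g (zs (s n))) < e"
      if "M \<le> m" "M \<le> n" for m n
      using close[of m] close[of n] M[OF that] unfolding dist_real_def by linarith
    then show "\<exists>M. \<forall>m\<ge>M. \<forall>n\<ge>M.
        dist (blinfun_apply g (zs (s m))) (blinfun_apply g (zs (s n))) < e" by blast
  qed
  define \<Phi> where "\<Phi> g = lim (\<lambda>k. blinfun_apply g (zs (s k)))" for g :: "'z \<Rightarrow>\<^sub>L real"
  have lim: "(\<lambda>k. blinfun_apply g (zs (s k))) \<longlonglongrightarrow> \<Phi> g" for g
    unfolding \<Phi>_def using V[of g] by (simp add: V_def Cauchy_convergent_iff convergent_LIMSEQ_iff)
  have "bounded_linear \<Phi>"
  proof (rule bounded_linear_intro)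
    show "\<Phi> (g + h) = \<Phi> g + \<Phi> h" for g h
      using tendsto_add[OF lim[of g] lim[of h]] lim[of "g + h"]
      by (auto simp: blinfun.add_left intro: LIMSEQ_unique)
    show "\<Phi> (r *\<^sub>R g) = r *\<^sub>R \<Phi> g" for r g
      using tendsto_scaleR[OF tendsto_const[of r] lim[of g]] lim[of "r *\<^sub>R g"]
      by (auto simp: blinfun.scaleR_left intro: LIMSEQ_unique)
    show "norm (\<Phi> g) \<le> norm g * K" for g
      using tendsto_norm[OF lim[of g]] by (rule LIMSEQ_le_const2) (use bd in auto)
  qed
  then have "blinfun_apply (Blinfun \<Phi>) = \<Phi>" by (rule bounded_linear_Blinfun_apply)
  moreover obtain z where "\<forall>g. blinfun_apply (Blinfun \<Phi>) g = blinfun_apply g z"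
    using refl by (auto simp: reflexive_space_def)
  ultimately have "weakly_tendsto (zs \<circ> s) z"
    using lim by (simp add: weakly_tendsto_def comp_def)
  then show ?thesis using s by blast
qed

section \<open>Convex risk measures are continuous on \<open>L\<^sup>p\<close>\<close>

lemma abs_add_powr_le:
  fixes a b p :: real
  assumes "0 \<le> p"
  shows "\<bar>a + b\<bar> powr p \<le> 2 powr p * (\<bar>a\<bar> powr p + \<bar>b\<bar> powr p)"
proof -
  have "\<bar>a + b\<bar> powr p \<le> (2 * max \<bar>a\<bar> \<bar>b\<bar>) powr p"
    using assms by (intro powr_mono2) auto
  also have "\<dots> = 2 powr p * max \<bar>a\<bar> \<bar>b\<bar> powr p"
    by (simp add: powr_mult)
  also have "max \<bar>a\<bar> \<bar>b\<bar> powr p \<le> \<bar>a\<bar> powr p + \<bar>b\<bar> powr p"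
    by (auto simp: max_def)
  finally show ?thesis by simp
qed

lemma LpD:
  assumes "X \<in> Lp M p"
  shows "X \<in> borel_measurable M" "integrable M (\<lambda>\<omega>. \<bar>X \<omega>\<bar> powr p)"
  using assms by (auto simp: Lp_def)

lemma Lp_dominated:
  assumes "Y \<in> Lp M p" "X \<in> borel_measurable M" "AE \<omega> in M. \<bar>X \<omega>\<bar> \<le> \<bar>Y \<omega>\<bar>" "0 \<le> p"
  shows "X \<in> Lp M p"
proof -
  have "integrable M (\<lambda>\<omega>. \<bar>X \<omega>\<bar> powr p)"
  proof (rule Bochner_Integration.integrable_bound[OF LpD(2)[OF assms(1)]])
    show "AE \<omega> in M. norm (\<bar>X \<omega>\<bar> powr p) \<le> norm (\<bar>Y \<omega>\<bar> powr p)"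
      using assms(3) by (rule AE_mp) (use assms(4) in \<open>auto intro!: AE_I2 powr_mono2\<close>)
  qed (use assms(2) in measurable)
  then show ?thesis using assms(2) by (simp add: Lp_def)
qed

lemma Lp_add:
  assumes "X \<in> Lp M p" "Y \<in> Lp M p" "0 \<le> p"
  shows "(\<lambda>\<omega>. X \<omega> + Y \<omega>) \<in> Lp M p"
proof -
  note [measurable] = LpD(1)[OF assms(1)] LpD(1)[OF assms(2)]
  have "integrable M (\<lambda>\<omega>. \<bar>X \<omega> + Y \<omega>\<bar> powr p)"
  proof (rule Bochner_Integration.integrable_bound)
    show "integrable M (\<lambda>\<omega>. 2 powr p * (\<bar>X \<omega>\<bar> powr p + \<bar>Y \<omega>\<bar> powr p))"
      using assms by (intro integrable_mult_right Bochner_Integration.integrable_add LpD)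
    show "AE \<omega> in M. norm (\<bar>X \<omega> + Y \<omega>\<bar> powr p) \<le> norm (2 powr p * (\<bar>X \<omega>\<bar> powr p + \<bar>Y \<omega>\<bar> powr p))"
      using abs_add_powr_le[OF assms(3)] by (intro AE_I2) simp
  qed measurable
  then show ?thesis by (simp add: Lp_def)
qed

lemma Lp_mult:
  assumes "X \<in> Lp M p"
  shows "(\<lambda>\<omega>. c * X \<omega>) \<in> Lp M p"
proof -
  note [measurable] = LpD(1)[OF assms]
  have "integrable M (\<lambda>\<omega>. \<bar>c\<bar> powr p * \<bar>X \<omega>\<bar> powr p)"
    using assms by (intro integrable_mult_right LpD)
  then show ?thesis by (simp add: Lp_def abs_mult powr_mult)
qed

lemma Lp_diff:
  assumes "X \<in> Lp M p" "Y \<in> Lp M p" "0 \<le> p"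
  shows "(\<lambda>\<omega>. X \<omega> - Y \<omega>) \<in> Lp M p"
  using Lp_add[OF assms(1) Lp_mult[OF assms(2), of "- 1"] assms(3)] by simp

text \<open>With \<open>W = (\<Sum>n. (2 ^ n * \<bar>D n\<bar>) powr p) powr (1 / p)\<close> neither Minkowski's inequality nor the
  completeness of \<open>L\<^sup>p\<close> is needed for the continuity of risk measures.\<close>

lemma Lp_common_majorant:
  assumes p: "0 < p" and D: "\<And>n::nat. D n \<in> Lp M p"
    and le: "\<And>n. (\<integral>\<omega>. \<bar>D n \<omega>\<bar> powr p \<partial>M) \<le> (1 / 2) ^ n * (1 / 2 ^ n) powr p"
  shows "\<exists>W\<in>Lp M p. AE \<omega> in M. \<forall>n. 2 ^ n * \<bar>D n \<omega>\<bar> \<le> W \<omega>"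
proof -
  note [measurable] = LpD(1)[OF D]
  \<comment> \<open>The assumed rate has two factors: \<open>(1 / 2 ^ n) powr p\<close> cancels the
    weight in \<open>u n\<close>, and \<open>(1 / 2) ^ n\<close> remains as a bound on its integral,
    so the sum of all \<open>u n\<close> has integral at most 2.\<close>
  define u where "u n \<omega> = (2 ^ n * \<bar>D n \<omega>\<bar>) powr p" for n \<omega>
  have u: "u n \<omega> = (2 ^ n) powr p * \<bar>D n \<omega>\<bar> powr p" for n \<omega>
    by (simp add: u_def powr_mult)
  have int: "integrable M (u n)" for n
    unfolding u using D by (intro integrable_mult_right LpD)
  have int_u: "(\<integral>\<omega>. u n \<omega> \<partial>M) \<le> (1 / 2) ^ n" for n
  proof -
    have "(\<integral>\<omega>. u n \<omega> \<partial>M) = (2 ^ n) powr p * (\<integral>\<omega>. \<bar>D n \<omega>\<bar> powr p \<partial>M)"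
      by (simp add: u)
    also have "\<dots> \<le> (2 ^ n) powr p * ((1 / 2) ^ n * (1 / 2 ^ n) powr p)"
      using le by (intro mult_left_mono) auto
    also have "\<dots> = (1 / 2) ^ n * ((2 ^ n) powr p * (1 / 2 ^ n) powr p)"
      by simp
    also have "(2 ^ n) powr p * (1 / 2 ^ n) powr p = (1::real)"
      by (subst powr_mult[symmetric]) auto
    finally show ?thesis by simp
  qed
  have u0: "0 \<le> u n \<omega>" for n \<omega> by (simp add: u_def)
  have fin: "(\<integral>\<^sup>+\<omega>. (\<Sum>n. ennreal (u n \<omega>)) \<partial>M) \<le> 2"
  proof -
    have "(\<integral>\<^sup>+\<omega>. (\<Sum>n. ennreal (u n \<omega>)) \<partial>M) = (\<Sum>n. \<integral>\<^sup>+\<omega>. ennreal (u n \<omega>) \<partial>M)"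
      using int by (intro nn_integral_suminf) auto
    also have "\<dots> = (\<Sum>n. ennreal (\<integral>\<omega>. u n \<omega> \<partial>M))"
      using int u0 by (simp add: nn_integral_eq_integral)
    also have "\<dots> \<le> (\<Sum>n. ennreal ((1 / 2) ^ n))"
      using int_u by (intro suminf_le ennreal_leI) auto
    also have "\<dots> = ennreal (\<Sum>n. (1 / 2) ^ n)"
      by (intro suminf_ennreal2) (auto intro: summable_geometric)
    also have "\<dots> = 2"
      by (simp add: suminf_geometric)
    finally show ?thesis .
  qed
  have um [measurable]: "u n \<in> borel_measurable M" for n
    using int by auto
  have AEfin: "AE \<omega> in M. (\<Sum>n. ennreal (u n \<omega>)) \<noteq> \<infinity>"
    using fin by (intro nn_integral_PInf_AE) (auto simp: top_unique)
  define S where "S \<omega> = enn2real (\<Sum>n. ennreal (u n \<omega>))" for \<omega>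
  define W where "W \<omega> = S \<omega> powr (1 / p)" for \<omega>
  have [measurable]: "S \<in> borel_measurable M" unfolding S_def by measurable
  have [measurable]: "W \<in> borel_measurable M" unfolding W_def by measurable
  have S0: "0 \<le> S \<omega>" for \<omega> by (simp add: S_def)
  have Wp: "\<bar>W \<omega>\<bar> powr p = S \<omega>" for \<omega>
    using p S0[of \<omega>] by (simp add: W_def powr_powr)
  have "integrable M S"
  proof (rule integrableI_bounded)
    have "(\<integral>\<^sup>+\<omega>. ennreal (norm (S \<omega>)) \<partial>M) \<le> (\<integral>\<^sup>+\<omega>. (\<Sum>n. ennreal (u n \<omega>)) \<partial>M)"
      by (intro nn_integral_mono) (simp add: S_def ennreal_enn2real_if)
    also have "\<dots> < \<infinity>" using fin by (simp add: le_less_trans[of _ "2::ennreal"])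
    finally show "(\<integral>\<^sup>+\<omega>. ennreal (norm (S \<omega>)) \<partial>M) < \<infinity>" .
  qed simp
  then have "W \<in> Lp M p" by (simp add: Lp_def Wp)
  moreover have "AE \<omega> in M. \<forall>n. 2 ^ n * \<bar>D n \<omega>\<bar> \<le> W \<omega>"
    using AEfin
  proof eventually_elim
    case (elim \<omega>)
    show ?case
    proof
      fix n
      have "ennreal (u n \<omega>) \<le> (\<Sum>k. ennreal (u k \<omega>))"
        using sum_le_suminf[of "\<lambda>k. ennreal (u k \<omega>)" "{n}"] by simp
      also have "\<dots> = ennreal (S \<omega>)"
        using elim by (simp add: S_def top.not_eq_extremum)
      finally have "u n \<omega> \<le> S \<omega>"
        using S0[of \<omega>] by (simp add: ennreal_le_iff)
      then have "u n \<omega> powr (1 / p) \<le> W \<omega>"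
        unfolding W_def using u0[of n \<omega>] p by (intro powr_mono2) auto
      then show "2 ^ n * \<bar>D n \<omega>\<bar> \<le> W \<omega>"
        using p by (simp add: u_def powr_powr)
    qed
  qed
  ultimately show ?thesis by blast
qed

lemma convex_risk_measure_mono:
  assumes "convex_risk_measure M p \<rho>" "X \<in> Lp M p" "Y \<in> Lp M p" "AE \<omega> in M. X \<omega> \<le> Y \<omega>"
  shows "\<rho> X \<le> \<rho> Y"
  using assms by (simp add: convex_risk_measure_def)

lemma convex_risk_measure_convex:
  assumes "convex_risk_measure M p \<rho>" "X \<in> Lp M p" "Y \<in> Lp M p" "0 \<le> c" "c \<le> 1"
  shows "\<rho> (\<lambda>\<omega>. c * X \<omega> + (1 - c) * Y \<omega>) \<le> c * \<rho> X + (1 - c) * \<rho> Y"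
  using assms by (simp add: convex_risk_measure_def)

text \<open>With the majorant \<open>W\<close>, the function \<open>X0 + \<bar>D n\<bar>\<close>
  lies below a convex combination of \<open>X0 + W\<close> and \<open>X0\<close> in which the first
  has weight \<open>(1 / 2) ^ n\<close>. Monotonicity and convexity then bound the increase of
  \<open>\<rho>\<close> by the same weight times a constant, which is finite because
  \<open>\<rho>\<close> is real-valued at \<open>X0 + W\<close>.\<close>

lemma convex_risk_measure_fast_tendsto:
  assumes \<rho>: "convex_risk_measure M p \<rho>" and p: "0 < p"
    and X: "\<And>n::nat. X n \<in> Lp M p" and X0: "X0 \<in> Lp M p"
    and le: "\<And>n. (\<integral>\<omega>. \<bar>X n \<omega> - X0 \<omega>\<bar> powr p \<partial>M) \<le> (1 / 2) ^ n * (1 / 2 ^ n) powr p"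
  shows "(\<lambda>n. \<rho> (X n)) \<longlonglongrightarrow> \<rho> X0"
proof -
  define D where "D n \<omega> = X n \<omega> - X0 \<omega>" for n \<omega>
  have D: "D n \<in> Lp M p" for n
    unfolding D_def using X X0 p by (intro Lp_diff) auto
  obtain W where W: "W \<in> Lp M p" "AE \<omega> in M. \<forall>n. 2 ^ n * \<bar>D n \<omega>\<bar> \<le> W \<omega>"
    using Lp_common_majorant[of p D M, OF p D] le unfolding D_def by blast
  define e where "e n = (1 / 2) ^ n * (\<rho> (\<lambda>\<omega>. X0 \<omega> + W \<omega>) - \<rho> X0)" for n :: nat
  have e: "e \<longlonglongrightarrow> 0"
    unfolding e_def by (intro tendsto_mult_left_zero LIMSEQ_realpow_zero) auto
  have X0W: "(\<lambda>\<omega>. X0 \<omega> + W \<omega>) \<in> Lp M p" using X0 W p by (intro Lp_add) auto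
  have up: "\<rho> Y \<le> \<rho> X0 + e n"
    if Y: "Y \<in> Lp M p" "AE \<omega> in M. Y \<omega> \<le> X0 \<omega> + \<bar>D n \<omega>\<bar>" for Y n
  proof -
    let ?c = "(1 / 2) ^ n :: real"
    have c: "0 \<le> ?c" "?c \<le> 1" by (auto simp: power_le_one)
    have "\<rho> Y \<le> \<rho> (\<lambda>\<omega>. ?c * (X0 \<omega> + W \<omega>) + (1 - ?c) * X0 \<omega>)"
    proof (rule convex_risk_measure_mono[OF \<rho> Y(1)])
      show "(\<lambda>\<omega>. ?c * (X0 \<omega> + W \<omega>) + (1 - ?c) * X0 \<omega>) \<in> Lp M p"
        using X0 W(1) p by (intro Lp_add Lp_mult) auto
      show "AE \<omega> in M. Y \<omega> \<le> ?c * (X0 \<omega> + W \<omega>) + (1 - ?c) * X0 \<omega>"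
        using Y(2) W(2)
      proof eventually_elim
        case (elim \<omega>)
        have "\<bar>D n \<omega>\<bar> \<le> ?c * W \<omega>"
          using elim(2)[rule_format, of n] by (simp add: power_divide field_simps)
        then show ?case using elim(1) by (simp add: algebra_simps)
      qed
    qed
    also have "\<dots> \<le> ?c * \<rho> (\<lambda>\<omega>. X0 \<omega> + W \<omega>) + (1 - ?c) * \<rho> X0"
      by (rule convex_risk_measure_convex[OF \<rho> X0W X0 c])
    also have "\<dots> = \<rho> X0 + e n" by (simp add: e_def algebra_simps)
    finally show ?thesis .
  qed
  have 1: "\<rho> (X n) \<le> \<rho> X0 + e n" for n
    by (rule up[OF X]) (auto simp: D_def)
  \<comment> \<open>\<open>X0\<close> is the midpoint of \<open>X n\<close> and its reflection \<open>2 * X0 - X n\<close>.\<close>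
  have 2: "\<rho> X0 - e n \<le> \<rho> (X n)" for n
  proof -
    have R: "(\<lambda>\<omega>. 2 * X0 \<omega> - X n \<omega>) \<in> Lp M p"
      using X X0 p by (intro Lp_diff Lp_mult) auto
    have "\<rho> X0 = \<rho> (\<lambda>\<omega>. 1/2 * X n \<omega> + (1 - 1/2) * (2 * X0 \<omega> - X n \<omega>))"
      by (rule arg_cong[where f = \<rho>]) (auto simp: fun_eq_iff algebra_simps)
    also have "\<dots> \<le> 1/2 * \<rho> (X n) + (1 - 1/2) * \<rho> (\<lambda>\<omega>. 2 * X0 \<omega> - X n \<omega>)"
      by (rule convex_risk_measure_convex[OF \<rho> X R]) auto
    also have "\<rho> (\<lambda>\<omega>. 2 * X0 \<omega> - X n \<omega>) \<le> \<rho> X0 + e n"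
      by (rule up[OF R]) (auto simp: D_def)
    finally show ?thesis by (simp add: field_simps)
  qed
  show ?thesis
  proof (rule tendsto_sandwich)
    show "(\<lambda>n. \<rho> X0 - e n) \<longlonglongrightarrow> \<rho> X0" using tendsto_diff[OF tendsto_const e] by simp
    show "(\<lambda>n. \<rho> X0 + e n) \<longlonglongrightarrow> \<rho> X0" using tendsto_add[OF tendsto_const e] by simp
  qed (use 1 2 in auto)
qed

text \<open>If convergence failed, indices with error at least \<open>\<epsilon>\<close> could be
  picked at which the distance to \<open>X0\<close> decays as fast as the previous lemma demands.
  The choice \<open>m\<close> need not be increasing.\<close>

theorem convex_risk_measure_tendsto:
  assumes \<rho>: "convex_risk_measure M p \<rho>" and p: "0 < p"
    and X: "\<And>n::nat. X n \<in> Lp M p" and X0: "X0 \<in> Lp M p"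
    and lim: "(\<lambda>n. \<integral>\<omega>. \<bar>X n \<omega> - X0 \<omega>\<bar> powr p \<partial>M) \<longlonglongrightarrow> 0"
  shows "(\<lambda>n. \<rho> (X n)) \<longlonglongrightarrow> \<rho> X0"
proof (rule ccontr)
  assume "\<not> ?thesis"
  then obtain \<epsilon> where \<epsilon>: "0 < \<epsilon>" and "\<exists>\<^sub>F n in sequentially. \<epsilon> \<le> dist (\<rho> (X n)) (\<rho> X0)"
    unfolding tendsto_iff not_all not_imp not_eventually not_less by blast
  then have fr: "\<exists>m\<ge>n. \<epsilon> \<le> dist (\<rho> (X m)) (\<rho> X0)" for n
    by (auto simp: frequently_sequentially)
  have "\<exists>m. \<epsilon> \<le> dist (\<rho> (X m)) (\<rho> X0) \<and>
      (\<integral>\<omega>. \<bar>X m \<omega> - X0 \<omega>\<bar> powr p \<partial>M) \<le> (1 / 2) ^ n * (1 / 2 ^ n) powr p" for n :: nat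
  proof -
    have "\<forall>\<^sub>F m in sequentially. (\<integral>\<omega>. \<bar>X m \<omega> - X0 \<omega>\<bar> powr p \<partial>M) < (1 / 2) ^ n * (1 / 2 ^ n) powr p"
      by (rule order_tendstoD(2)[OF lim]) simp
    then obtain N where "\<And>m. N \<le> m \<Longrightarrow> (\<integral>\<omega>. \<bar>X m \<omega> - X0 \<omega>\<bar> powr p \<partial>M) < (1 / 2) ^ n * (1 / 2 ^ n) powr p"
      by (auto simp: eventually_sequentially)
    then show ?thesis using fr[of N] by (auto intro: less_imp_le)
  qed
  then obtain m where m: "\<And>n. \<epsilon> \<le> dist (\<rho> (X (m n))) (\<rho> X0)"
      "\<And>n. (\<integral>\<omega>. \<bar>X (m n) \<omega> - X0 \<omega>\<bar> powr p \<partial>M) \<le> (1 / 2) ^ n * (1 / 2 ^ n) powr p"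
    by metis
  have "(\<lambda>n. \<rho> (X (m n))) \<longlonglongrightarrow> \<rho> X0"
    by (rule convex_risk_measure_fast_tendsto[OF \<rho> p X X0 m(2)])
  then have "\<forall>\<^sub>F n in sequentially. dist (\<rho> (X (m n))) (\<rho> X0) < \<epsilon>"
    using \<epsilon> by (rule tendstoD)
  then show False using m(1) by (auto simp: eventually_sequentially not_less[symmetric])
qed

text \<open>Scheffe's lemma applied to the \<open>p\<close>-th powers yields convergence of the
  differences \<open>A n\<close> in \<open>L^1\<close>. What
  \<open>\<bar>X n - X0\<bar> powr p\<close> has in excess of a multiple of
  \<open>\<bar>A n\<bar>\<close> is dominated by an integrable function that does not depend on
  \<open>n\<close>.\<close>

lemma Lp_tendsto_Scheffe:
  fixes X :: "nat \<Rightarrow> 'a \<Rightarrow> real"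
  assumes p: "0 < p" and X: "\<And>n. X n \<in> Lp M p" and X0: "X0 \<in> Lp M p"
    and AE: "AE \<omega> in M. (\<lambda>n. X n \<omega>) \<longlonglongrightarrow> X0 \<omega>"
    and mom: "(\<lambda>n. \<integral>\<omega>. \<bar>X n \<omega>\<bar> powr p \<partial>M) \<longlonglongrightarrow> (\<integral>\<omega>. \<bar>X0 \<omega>\<bar> powr p \<partial>M)"
  shows "(\<lambda>n. \<integral>\<omega>. \<bar>X n \<omega> - X0 \<omega>\<bar> powr p \<partial>M) \<longlonglongrightarrow> 0"
proof -
  note [measurable] = LpD(1)[OF X] LpD(1)[OF X0]
  define c :: real where "c = 2 powr p"
  have c: "0 < c" by (simp add: c_def)
  define A where "A n \<omega> = \<bar>X n \<omega>\<bar> powr p - \<bar>X0 \<omega>\<bar> powr p" for n \<omega>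
  have intA: "integrable M (A n)" for n
    unfolding A_def using X X0 by (intro Bochner_Integration.integrable_diff LpD)
  have intD: "integrable M (\<lambda>\<omega>. \<bar>X n \<omega> - X0 \<omega>\<bar> powr p)" for n
    using X X0 p by (intro LpD Lp_diff) auto
  have limpowr: "AE \<omega> in M. (\<lambda>n. \<bar>X n \<omega>\<bar> powr p) \<longlonglongrightarrow> \<bar>X0 \<omega>\<bar> powr p"
    using AE
  proof eventually_elim
    case (elim \<omega>)
    then show ?case using p by (intro tendsto_powr' tendsto_rabs tendsto_const) auto
  qed
  have "(\<lambda>n. \<integral>\<^sup>+\<omega>. norm (\<bar>X n \<omega>\<bar> powr p - \<bar>X0 \<omega>\<bar> powr p) \<partial>M) \<longlonglongrightarrow> 0"
  proof (rule Scheffe_lemma1)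
    have eq: "(\<integral>\<^sup>+\<omega>. ennreal (norm (\<bar>Y \<omega>\<bar> powr p)) \<partial>M) = ennreal (\<integral>\<omega>. \<bar>Y \<omega>\<bar> powr p \<partial>M)"
      if "Y \<in> Lp M p" for Y
      using nn_integral_eq_integral[OF LpD(2)[OF that]] by simp
    have "(\<lambda>n. \<integral>\<^sup>+\<omega>. ennreal (norm (\<bar>X n \<omega>\<bar> powr p)) \<partial>M) \<longlonglongrightarrow> (\<integral>\<^sup>+\<omega>. ennreal (norm (\<bar>X0 \<omega>\<bar> powr p)) \<partial>M)"
      unfolding eq[OF X] eq[OF X0] by (rule tendsto_ennrealI[OF mom])
    then show "limsup (\<lambda>n. \<integral>\<^sup>+\<omega>. ennreal (norm (\<bar>X n \<omega>\<bar> powr p)) \<partial>M)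
        \<le> (\<integral>\<^sup>+\<omega>. ennreal (norm (\<bar>X0 \<omega>\<bar> powr p)) \<partial>M)"
      using lim_imp_Limsup[OF sequentially_bot] by fastforce
    show "integrable M (\<lambda>\<omega>. \<bar>X n \<omega>\<bar> powr p)" for n by (rule LpD(2)[OF X])
    show "integrable M (\<lambda>\<omega>. \<bar>X0 \<omega>\<bar> powr p)" by (rule LpD(2)[OF X0])
  qed (rule limpowr)
  then have "(\<lambda>n. ennreal (\<integral>\<omega>. norm (A n \<omega>) \<partial>M)) \<longlonglongrightarrow> ennreal 0"
    using nn_integral_eq_integral[OF integrable_norm[OF intA]] by (simp add: A_def)
  then have limA: "(\<lambda>n. \<integral>\<omega>. \<bar>A n \<omega>\<bar> \<partial>M) \<longlonglongrightarrow> 0"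
    by (subst (asm) tendsto_ennreal_iff) auto
  \<comment> \<open>Subtracting \<open>c * \<bar>A n\<bar>\<close> removes the part of
    \<open>\<bar>X n\<bar> powr p\<close> without a fixed majorant;
    \<open>2 * c * \<bar>X0\<bar> powr p\<close> dominates the rest.\<close>
  define R where "R n \<omega> = max 0 (\<bar>X n \<omega> - X0 \<omega>\<bar> powr p - c * \<bar>A n \<omega>\<bar>)" for n \<omega>
  have pw: "\<bar>X n \<omega> - X0 \<omega>\<bar> powr p - c * \<bar>A n \<omega>\<bar> \<le> 2 * c * \<bar>X0 \<omega>\<bar> powr p" for n \<omega>
  proof -
    have "\<bar>X n \<omega> - X0 \<omega>\<bar> powr p \<le> c * (\<bar>X n \<omega>\<bar> powr p + \<bar>X0 \<omega>\<bar> powr p)"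
      using abs_add_powr_le[of p "X n \<omega>" "- X0 \<omega>"] p by (simp add: c_def)
    also have "\<dots> \<le> c * (\<bar>A n \<omega>\<bar> + 2 * \<bar>X0 \<omega>\<bar> powr p)"
      using c by (intro mult_left_mono) (auto simp: A_def)
    finally show ?thesis by (simp add: algebra_simps)
  qed
  have [measurable]: "A n \<in> borel_measurable M" for n using intA by auto
  have Rm [measurable]: "R n \<in> borel_measurable M" for n
    unfolding R_def by measurable
  have "(\<lambda>n. \<integral>\<omega>. R n \<omega> \<partial>M) \<longlonglongrightarrow> (\<integral>\<omega>. 0 \<partial>M)"
  proof (rule integral_dominated_convergence[where w = "\<lambda>\<omega>. 2 * c * \<bar>X0 \<omega>\<bar> powr p"])
    show "AE \<omega> in M. (\<lambda>n. R n \<omega>) \<longlonglongrightarrow> 0"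
      using AE limpowr
    proof eventually_elim
      case (elim \<omega>)
      have "(\<lambda>n. \<bar>X n \<omega> - X0 \<omega>\<bar> powr p) \<longlonglongrightarrow> \<bar>X0 \<omega> - X0 \<omega>\<bar> powr p"
        using p by (intro tendsto_powr' tendsto_rabs tendsto_diff tendsto_const elim(1)) auto
      moreover have "(\<lambda>n. c * \<bar>A n \<omega>\<bar>) \<longlonglongrightarrow> c * \<bar>\<bar>X0 \<omega>\<bar> powr p - \<bar>X0 \<omega>\<bar> powr p\<bar>"
        unfolding A_def by (intro tendsto_mult tendsto_rabs tendsto_diff tendsto_const elim(2))
      ultimately have "(\<lambda>n. R n \<omega>) \<longlonglongrightarrow> max 0 (\<bar>X0 \<omega> - X0 \<omega>\<bar> powr p - c * \<bar>\<bar>X0 \<omega>\<bar> powr p - \<bar>X0 \<omega>\<bar> powr p\<bar>)"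
        unfolding R_def by (intro tendsto_max tendsto_diff tendsto_const)
      then show ?case using p by simp
    qed
    show "AE \<omega> in M. norm (R n \<omega>) \<le> 2 * c * \<bar>X0 \<omega>\<bar> powr p" for n
      using pw c by (intro AE_I2) (simp add: R_def)
  qed (use LpD(2)[OF X0] in auto)
  then have limR: "(\<lambda>n. (\<integral>\<omega>. R n \<omega> \<partial>M) + c * (\<integral>\<omega>. \<bar>A n \<omega>\<bar> \<partial>M)) \<longlonglongrightarrow> 0"
    using tendsto_add[OF _ tendsto_mult_left[OF limA, of c]] by fastforce
  have intR: "integrable M (R n)" for n
    unfolding R_def using intD[of n] intA[of n] by (intro integrable_max) auto
  have "(\<integral>\<omega>. \<bar>X n \<omega> - X0 \<omega>\<bar> powr p \<partial>M) \<le> (\<integral>\<omega>. R n \<omega> \<partial>M) + c * (\<integral>\<omega>. \<bar>A n \<omega>\<bar> \<partial>M)" for n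
  proof -
    have "(\<integral>\<omega>. \<bar>X n \<omega> - X0 \<omega>\<bar> powr p \<partial>M) \<le> (\<integral>\<omega>. R n \<omega> + c * \<bar>A n \<omega>\<bar> \<partial>M)"
      using intR[of n] intA[of n] intD[of n] by (intro integral_mono) (auto simp: R_def)
    also have "\<dots> = (\<integral>\<omega>. R n \<omega> \<partial>M) + c * (\<integral>\<omega>. \<bar>A n \<omega>\<bar> \<partial>M)"
      using intR[of n] intA[of n] by simp
    finally show ?thesis .
  qed
  then show ?thesis
    by (intro tendsto_sandwich[OF _ _ tendsto_const limR]) auto
qed

section \<open>The strong law of large numbers\<close>

text \<open>The maximum of the partial sums \<open>\<Sum>i<k. x i\<close> with \<open>k \<le> n\<close>, written as a recursion on the shifted
  sequence as needed for Garsia's proof of the maximal ergodic inequality.\<close>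

primrec partial_max :: "nat \<Rightarrow> (nat \<Rightarrow> real) \<Rightarrow> real" where
  "partial_max 0 x = 0"
| "partial_max (Suc n) x = max 0 (x 0 + partial_max n (\<lambda>i. x (Suc i)))"

lemma partial_max_nonneg: "0 \<le> partial_max n x"
  by (cases n) auto

lemma partial_max_Suc_ge: "partial_max n x \<le> partial_max (Suc n) x"
proof (induction n arbitrary: x)
  case (Suc n)
  show ?case using Suc[of "\<lambda>i. x (Suc i)"] by simp
qed simp

lemma partial_max_ge_sum: "k \<le> n \<Longrightarrow> (\<Sum>i<k. x i) \<le> partial_max n x"
proof (induction n arbitrary: x k)
  case (Suc n)
  show ?case
  proof (cases k)
    case (Suc k')
    have "(\<Sum>i<k'. x (Suc i)) \<le> partial_max n (\<lambda>i. x (Suc i))"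
      using Suc Suc.IH Suc.prems by simp
    then show ?thesis
      unfolding Suc sum.lessThan_Suc_shift by simp
  qed (simp add: partial_max_nonneg)
qed simp

lemma partial_max_le: "partial_max n x \<le> (\<Sum>i<n. \<bar>x i\<bar>)"
proof (induction n arbitrary: x)
  case (Suc n)
  show ?case
    using Suc[of "\<lambda>i. x (Suc i)"] unfolding sum.lessThan_Suc_shift
    by (simp add: sum_nonneg add_nonneg_nonneg)
qed simp

lemma borel_measurable_partial_max_fun:
  "(\<And>i::nat. X i \<in> borel_measurable M) \<Longrightarrow> (\<lambda>\<omega>. partial_max n (\<lambda>i. X i \<omega>)) \<in> borel_measurable M"
proof (induction n arbitrary: X)
  case (Suc n)
  have [measurable]: "(\<lambda>\<omega>. partial_max n (\<lambda>i. X (Suc i) \<omega>)) \<in> borel_measurable M"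
    using Suc by simp
  have [measurable]: "X 0 \<in> borel_measurable M" using Suc by simp
  show ?case by simp
qed simp

text \<open>The pointwise core of Garsia's argument. Where the maximum is positive it equals
  \<open>x 0\<close> plus the maximum of the shifted sequence over one step less; elsewhere it is 0
  and the left side is at most 0. For a stationary sequence the left side has integral 0.\<close>

lemma partial_max_split:
  "partial_max (Suc n) x - partial_max (Suc n) (\<lambda>i. x (Suc i))
     \<le> x 0 * indicator {0<..} (partial_max (Suc n) x)"
proof (cases "0 < partial_max (Suc n) x")
  case True
  then show ?thesis
    using partial_max_Suc_ge[of n "\<lambda>i. x (Suc i)"] by (auto simp del: partial_max.simps(2) simp: partial_max.simps(2)[of n x])
next
  case False
  then show ?thesis
    using partial_max_nonneg[of "Suc n" "\<lambda>i. x (Suc i)"] partial_max_nonneg[of "Suc n" x]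
    by (simp del: partial_max.simps(2))
qed

declare partial_max.simps(2) [simp del]

section \<open>Stationarity, the maximal inequality and the law of large numbers\<close>

context prob_space
begin

text \<open>Used with \<open>Suc\<close>, both for shifting a sequence and for renumbering a sample
  that starts at 1.\<close>

lemma indep_vars_reindex:
  assumes f: "inj_on f I" and indep: "indep_vars N X (f ` I)"
  shows "indep_vars (\<lambda>i. N (f i)) (\<lambda>i. X (f i)) I"
proof -
  have *: "prob (\<Inter>j\<in>J. A j) = (\<Prod>j\<in>J. prob (A j))"
    if J: "J \<subseteq> I" "J \<noteq> {}" "finite J"
      and A: "A \<in> Pi J (\<lambda>i. {X (f i) -` B \<inter> space M |B. B \<in> sets (N (f i))})" for J A
  proof -
    define A' where "A' k = A (the_inv_into J f k)" for k
    have inj: "inj_on f J" using f J(1) by (rule inj_on_subset)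
    have A': "A' (f j) = A j" if "j \<in> J" for j
      using that by (simp add: A'_def the_inv_into_f_f[OF inj])
    have "A' \<in> Pi (f ` J) (\<lambda>k. {X k -` B \<inter> space M |B. B \<in> sets (N k)})"
    proof
      fix k assume "k \<in> f ` J"
      then obtain j where "j \<in> J" "k = f j" by blast
      then show "A' k \<in> {X k -` B \<inter> space M |B. B \<in> sets (N k)}"
        using A A'[of j] by (auto simp: Pi_iff)
    qed
    then have "prob (\<Inter>k\<in>f ` J. A' k) = (\<Prod>k\<in>f ` J. prob (A' k))"
      using conjunct2[OF indep[unfolded indep_vars_def2 indep_sets_def], THEN conjunct2, rule_format, OF image_mono[OF J(1)], of A'] J
      by simp
    then show ?thesis
      using A' by (simp add: prod.reindex[OF inj])
  qed
  show ?thesis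
    using indep unfolding indep_vars_def2 indep_sets_def by (intro conjI) (auto intro!: *)
qed

text \<open>Both joint laws are the product of the same marginals. This stationarity is what the
  maximal inequality takes from independence.\<close>

lemma iid_shift_distr:
  fixes X :: "nat \<Rightarrow> 'a \<Rightarrow> real"
  assumes indep: "indep_vars (\<lambda>_. borel) X UNIV"
    and id: "\<And>i. distr M borel (X i) = D"
  shows "distr M (PiM UNIV (\<lambda>_. borel)) (\<lambda>\<omega> i. X (Suc i) \<omega>) = distr M (PiM UNIV (\<lambda>_. borel)) (\<lambda>\<omega> i. X i \<omega>)"
proof -
  have X: "X i \<in> borel_measurable M" for i
    using indep by (simp add: indep_vars_def)
  have indep': "indep_vars (\<lambda>_. borel) (\<lambda>i. X (Suc i)) UNIV"
    using indep_vars_reindex[of Suc UNIV "\<lambda>_. borel" X] indep_vars_subset[OF indep] by simp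
  have *: "(\<lambda>x. \<lambda>i\<in>UNIV. Y i x) = (\<lambda>x i. Y i x)" for Y :: "nat \<Rightarrow> 'a \<Rightarrow> real"
    by (simp add: restrict_def)
  have "distr M (PiM UNIV (\<lambda>_. borel)) (\<lambda>\<omega> i. X (Suc i) \<omega>) = PiM UNIV (\<lambda>i. distr M borel (X (Suc i)))"
    using indep' X by (subst (asm) indep_vars_iff_distr_eq_PiM) (auto simp: *)
  also have "\<dots> = PiM UNIV (\<lambda>i. distr M borel (X i))"
    by (simp add: id)
  also have "\<dots> = distr M (PiM UNIV (\<lambda>_. borel)) (\<lambda>\<omega> i. X i \<omega>)"
    using indep X by (subst (asm) indep_vars_iff_distr_eq_PiM) (auto simp: *)
  finally show ?thesis .
qed

lemma iid_integral_shift: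
  fixes X :: "nat \<Rightarrow> 'a \<Rightarrow> real" and \<Phi> :: "(nat \<Rightarrow> real) \<Rightarrow> real"
  assumes indep: "indep_vars (\<lambda>_. borel) X UNIV"
    and id: "\<And>i. distr M borel (X i) = D"
    and \<Phi>: "\<Phi> \<in> borel_measurable (PiM UNIV (\<lambda>_. borel))"
  shows "(\<integral>\<omega>. \<Phi> (\<lambda>i. X (Suc i) \<omega>) \<partial>M) = (\<integral>\<omega>. \<Phi> (\<lambda>i. X i \<omega>) \<partial>M)"
proof -
  have X [measurable]: "X i \<in> borel_measurable M" for i
    using indep by (simp add: indep_vars_def)
  have m: "(\<lambda>\<omega> i. Y i \<omega>) \<in> M \<rightarrow>\<^sub>M PiM UNIV (\<lambda>_. borel)"
    if "\<And>i. Y i \<in> borel_measurable M" for Y :: "nat \<Rightarrow> 'a \<Rightarrow> real"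
    using that by (intro measurable_PiM_single') auto
  have "(\<integral>\<omega>. \<Phi> (\<lambda>i. X (Suc i) \<omega>) \<partial>M) = (\<integral>x. \<Phi> x \<partial>distr M (PiM UNIV (\<lambda>_. borel)) (\<lambda>\<omega> i. X (Suc i) \<omega>))"
    by (rule integral_distr[symmetric, OF m \<Phi>]) simp
  also have "\<dots> = (\<integral>x. \<Phi> x \<partial>distr M (PiM UNIV (\<lambda>_. borel)) (\<lambda>\<omega> i. X i \<omega>))"
    by (simp add: iid_shift_distr[OF indep id])
  also have "\<dots> = (\<integral>\<omega>. \<Phi> (\<lambda>i. X i \<omega>) \<partial>M)"
    by (rule integral_distr[OF m \<Phi>]) simp
  finally show ?thesis .
qed

text \<open>Integrating \<open>partial_max_split\<close> for \<open>Y = X - a\<close> makes the left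
  side vanish, so \<open>a\<close> times the probability of a positive maximum is at most the
  integral of \<open>X 0\<close> over that event, hence at most
  \<open>expectation (X 0)\<close>.\<close>

lemma iid_maximal_inequality:
  fixes X :: "nat \<Rightarrow> 'a \<Rightarrow> real"
  assumes indep: "indep_vars (\<lambda>_. borel) X UNIV"
    and id: "\<And>i. distr M borel (X i) = D"
    and int: "integrable M (X 0)" and nonneg: "\<And>i \<omega>. 0 \<le> X i \<omega>" and a: "0 < a"
  shows "prob {\<omega>\<in>space M. \<exists>k>0. real k * a < (\<Sum>i<k. X i \<omega>)} \<le> expectation (X 0) / a"
proof -
  have X [measurable]: "X i \<in> borel_measurable M" for i
    using indep by (simp add: indep_vars_def)
  have intX: "integrable M (X i)" for i
  proof -
    have "integrable (distr M borel (X 0)) (\<lambda>x. x)"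
      using int by (subst integrable_distr_eq) auto
    then have "integrable (distr M borel (X i)) (\<lambda>x. x)" by (simp add: id)
    then show ?thesis by (subst (asm) integrable_distr_eq) auto
  qed
  define Y where "Y i \<omega> = X i \<omega> - a" for i \<omega>
  have Y [measurable]: "Y i \<in> borel_measurable M" for i
    unfolding Y_def by simp
  have intY: "integrable M (Y i)" for i
    unfolding Y_def using intX by simp
  have indepY: "indep_vars (\<lambda>_. borel) Y UNIV"
    unfolding Y_def using indep_vars_compose2[OF indep, of "\<lambda>_ x. x - a"] by simp
  have idY: "distr M borel (Y i) = distr D borel (\<lambda>x. x - a)" for i
  proof -
    have "distr (distr M borel (X i)) borel (\<lambda>x. x - a) = distr M borel (Y i)"
      by (subst distr_distr) (auto simp: Y_def[abs_def] comp_def)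
    then show ?thesis by (simp add: id)
  qed
  \<comment> \<open>The maximum only sees finitely many partial sums; the bound is uniform in the
    horizon \<open>n\<close> and passes to the increasing union.\<close>
  define A where "A n = {\<omega>\<in>space M. \<exists>k\<in>{0<..n}. real k * a < (\<Sum>i<k. X i \<omega>)}" for n
  have [measurable]: "A n \<in> sets M" for n unfolding A_def by measurable
  have "prob (A (Suc n)) \<le> expectation (X 0) / a" for n
  proof -
    let ?m = "\<lambda>\<omega>. partial_max (Suc n) (\<lambda>i. Y i \<omega>)"
    let ?m' = "\<lambda>\<omega>. partial_max (Suc n) (\<lambda>i. Y (Suc i) \<omega>)"
    have m [measurable]: "?m \<in> borel_measurable M" "?m' \<in> borel_measurable M"
      by (rule borel_measurable_partial_max_fun, simp)+
    have intm: "integrable M (\<lambda>\<omega>. partial_max (Suc n) (\<lambda>i. Z i \<omega>))"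
      if Z: "\<And>i. integrable M (Z i)" for Z :: "nat \<Rightarrow> 'a \<Rightarrow> real"
    proof (rule Bochner_Integration.integrable_bound)
      show "integrable M (\<lambda>\<omega>. \<Sum>i<Suc n. \<bar>Z i \<omega>\<bar>)" using Z by auto
      show "(\<lambda>\<omega>. partial_max (Suc n) (\<lambda>i. Z i \<omega>)) \<in> borel_measurable M"
        by (rule borel_measurable_partial_max_fun) (use Z in auto)
      show "AE \<omega> in M. norm (partial_max (Suc n) (\<lambda>i. Z i \<omega>)) \<le> norm (\<Sum>i<Suc n. \<bar>Z i \<omega>\<bar>)"
        using partial_max_le[of "Suc n"] partial_max_nonneg[of "Suc n"]
        by (intro AE_I2) (simp del: sum.lessThan_Suc add: sum_nonneg)
    qed
    have intind: "integrable M (\<lambda>\<omega>. Z \<omega> * indicator {0<..} (?m \<omega>))" if "integrable M Z" for Z :: "'a \<Rightarrow> real"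
    proof (rule Bochner_Integration.integrable_bound[OF that])
      show "(\<lambda>\<omega>. Z \<omega> * indicator {0<..} (?m \<omega>)) \<in> borel_measurable M" using that by simp
    qed (auto simp: indicator_def)
    have "(\<integral>\<omega>. ?m' \<omega> \<partial>M) = (\<integral>\<omega>. ?m \<omega> \<partial>M)"
      by (rule iid_integral_shift[OF indepY idY, of "partial_max (Suc n)"])
         (rule borel_measurable_partial_max_fun[where X = "\<lambda>i x. x i"], simp)
    then have "0 = (\<integral>\<omega>. ?m \<omega> - ?m' \<omega> \<partial>M)"
      using intm[of Y] intm[of "\<lambda>i. Y (Suc i)"] intY by (subst Bochner_Integration.integral_diff) auto
    also have "\<dots> \<le> (\<integral>\<omega>. Y 0 \<omega> * indicator {0<..} (?m \<omega>) \<partial>M)"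
      using intm[of Y] intm[of "\<lambda>i. Y (Suc i)"] intY partial_max_split[of n]
      by (intro integral_mono intind) auto
    also have "\<dots> = (\<integral>\<omega>. X 0 \<omega> * indicator {0<..} (?m \<omega>) - a * indicator {0<..} (?m \<omega>) \<partial>M)"
      by (simp add: Y_def algebra_simps)
    also have "\<dots> = (\<integral>\<omega>. X 0 \<omega> * indicator {0<..} (?m \<omega>) \<partial>M) - (\<integral>\<omega>. a * indicator {0<..} (?m \<omega>) \<partial>M)"
      using intind[OF int] intind[of "\<lambda>_. a"]
      by (intro Bochner_Integration.integral_diff) auto
    also have "(\<integral>\<omega>. X 0 \<omega> * indicator {0<..} (?m \<omega>) \<partial>M) \<le> expectation (X 0)"
      using nonneg by (intro integral_mono intind int) (auto simp: indicator_def)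
    finally have le: "(\<integral>\<omega>. a * indicator {0<..} (?m \<omega>) \<partial>M) \<le> expectation (X 0)" by simp
    have "a * prob (A (Suc n)) = (\<integral>\<omega>. a * indicator (A (Suc n)) \<omega> \<partial>M)"
      by simp
    also have "\<dots> \<le> (\<integral>\<omega>. a * indicator {0<..} (?m \<omega>) \<partial>M)"
    proof (intro integral_mono)
      fix \<omega>
      show "a * indicator (A (Suc n)) \<omega> \<le> a * indicator {0<..} (?m \<omega>)"
      proof (cases "\<omega> \<in> A (Suc n)")
        case True
        then obtain k where k: "0 < k" "k \<le> Suc n" "real k * a < (\<Sum>i<k. X i \<omega>)"
          by (auto simp: A_def)
        have "0 < (\<Sum>i<k. Y i \<omega>)" using k by (simp add: Y_def sum_subtractf)
        then have "0 < ?m \<omega>" using partial_max_ge_sum[OF k(2), of "\<lambda>i. Y i \<omega>"] by linarith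
        then show ?thesis using a by simp
      qed (use a in \<open>simp add: indicator_def\<close>)
      show "integrable M (\<lambda>\<omega>. a * indicator (A (Suc n)) \<omega>)"
        by (intro integrable_mult_right integrable_real_indicator) (auto simp: emeasure_eq_measure)
    qed (use intind[of "\<lambda>_. a"] in auto)
    also note le
    finally show ?thesis using a by (simp add: pos_le_divide_eq mult.commute)
  qed
  moreover have "(\<lambda>n. prob (A (Suc n))) \<longlonglongrightarrow> prob (\<Union>n. A (Suc n))"
  proof (rule finite_Lim_measure_incseq)
    show "incseq (\<lambda>n. A (Suc n))"
      unfolding incseq_def A_def by fastforce
  qed auto
  ultimately have "prob (\<Union>n. A (Suc n)) \<le> expectation (X 0) / a"
    by (intro LIMSEQ_le_const2) auto
  also have "(\<Union>n. A (Suc n)) = {\<omega>\<in>space M. \<exists>k>0. real k * a < (\<Sum>i<k. X i \<omega>)}"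
  proof (intro set_eqI iffI)
    fix \<omega> assume "\<omega> \<in> {\<omega>\<in>space M. \<exists>k>0. real k * a < (\<Sum>i<k. X i \<omega>)}"
    then obtain k where k: "\<omega> \<in> space M" "0 < k" "real k * a < (\<Sum>i<k. X i \<omega>)" by blast
    have "\<omega> \<in> A (Suc k)" unfolding A_def using k by (intro CollectI conjI bexI[of _ k]) auto
    then show "\<omega> \<in> (\<Union>n. A (Suc n))" by blast
  qed (auto simp: A_def)
  finally show ?thesis .
qed

text \<open>Hoeffding's bound decays geometrically in the sample size, so Borel-Cantelli applies to
  each of the tolerances \<open>1 / (j + 1)\<close>.\<close>

lemma strong_law_bounded:
  fixes X :: "nat \<Rightarrow> 'a \<Rightarrow> real"
  assumes indep: "indep_vars (\<lambda>_. borel) X UNIV"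
    and id: "\<And>i. distr M borel (X i) = D"
    and bnd: "\<And>i \<omega>. X i \<omega> \<in> {0..c}"
  shows "AE \<omega> in M. (\<lambda>n. (\<Sum>i<n. X i \<omega>) / real n) \<longlonglongrightarrow> expectation (X 0)"
proof -
  have X [measurable]: "X i \<in> borel_measurable M" for i
    using indep by (simp add: indep_vars_def)
  \<comment> \<open>The Hoeffding bound divides by the squared length of the range, and
    \<open>c\<close> may be 0.\<close>
  define d where "d = c + 1"
  have d: "0 < d" using bnd[of 0 undefined] by (simp add: d_def)
  have dev: "prob {\<omega>\<in>space M. \<epsilon> \<le> \<bar>(\<Sum>i<Suc n. X i \<omega>) / real (Suc n) - expectation (X 0)\<bar>}
      \<le> 2 * exp (- 2 * \<epsilon>\<^sup>2 / d\<^sup>2) ^ Suc n" if \<epsilon>: "0 < \<epsilon>" for \<epsilon> n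
  proof -
    interpret H: Hoeffding_ineq_iid M "{..<Suc n}" X "X 0" 0 d "expectation (X 0)"
    proof unfold_locales
      show "indep_vars (\<lambda>_. borel) X {..<Suc n}" by (rule indep_vars_subset[OF indep]) simp
      show "distr M borel (X i) = distr M borel (X 0)" for i by (simp add: id)
      have "X 0 \<omega> \<in> {0..d}" for \<omega> using bnd[of 0 \<omega>] by (simp add: d_def)
      then show "AE \<omega> in M. X 0 \<omega> \<in> {0..d}" by (intro AE_I2)
    qed simp_all
    have "prob {\<omega>\<in>space M. \<epsilon> \<le> \<bar>(\<Sum>i<Suc n. X i \<omega>) / real (Suc n) - expectation (X 0)\<bar>}
        \<le> 2 * exp (- 2 * real (Suc n) * \<epsilon>\<^sup>2 / d\<^sup>2)"
    proof -
      have "{..<Suc n} \<noteq> {}" by auto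
      from H.Hoeffding_ineq_abs_ge'[OF less_imp_le[OF \<epsilon>] d this] show ?thesis
        by (simp only: card_lessThan diff_zero)
    qed
    also have "exp (- 2 * real (Suc n) * \<epsilon>\<^sup>2 / d\<^sup>2) = exp (real (Suc n) * (- 2 * \<epsilon>\<^sup>2 / d\<^sup>2))"
      by (simp add: mult.assoc mult.left_commute del: of_nat_Suc)
    also have "\<dots> = exp (- 2 * \<epsilon>\<^sup>2 / d\<^sup>2) ^ Suc n" by (rule exp_of_nat_mult)
    finally show ?thesis .
  qed
  have "AE \<omega> in M. \<forall>\<^sub>F n in sequentially.
      \<bar>(\<Sum>i<Suc n. X i \<omega>) / real (Suc n) - expectation (X 0)\<bar> < 1 / real (Suc j)" for j
  proof -
    let ?e = "1 / real (Suc j)"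
    let ?A = "\<lambda>n. {\<omega>\<in>space M. ?e \<le> \<bar>(\<Sum>i<Suc n. X i \<omega>) / real (Suc n) - expectation (X 0)\<bar>}"
    have "summable (\<lambda>n. prob (?A n))"
    proof (rule summable_comparison_test'[where N = 0])
      show "summable (\<lambda>n. 2 * exp (- 2 * ?e\<^sup>2 / d\<^sup>2) ^ Suc n)"
        using d by (intro summable_mult) (simp add: summable_Suc_iff del: power_Suc)
      show "norm (prob (?A n)) \<le> 2 * exp (- 2 * ?e\<^sup>2 / d\<^sup>2) ^ Suc n" for n
        using dev[of ?e n] by (simp del: sum.lessThan_Suc of_nat_Suc power_Suc)
    qed
    then have "AE \<omega> in M. \<forall>\<^sub>F n in sequentially. \<omega> \<in> space M - ?A n"
      by (intro borel_cantelli_AE1) (auto simp: emeasure_eq_measure)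
    then show ?thesis
      by (rule AE_mp) (auto intro!: AE_I2 elim!: eventually_mono simp: not_le simp del: sum.lessThan_Suc of_nat_Suc)
  qed
  then have "AE \<omega> in M. \<forall>j. \<forall>\<^sub>F n in sequentially.
      \<bar>(\<Sum>i<Suc n. X i \<omega>) / real (Suc n) - expectation (X 0)\<bar> < 1 / real (Suc j)"
    by (simp add: AE_all_countable)
  then show ?thesis
  proof eventually_elim
    fix \<omega>
    assume *: "\<forall>j. \<forall>\<^sub>F n in sequentially.
      \<bar>(\<Sum>i<Suc n. X i \<omega>) / real (Suc n) - expectation (X 0)\<bar> < 1 / real (Suc j)"
    have "(\<lambda>n. (\<Sum>i<Suc n. X i \<omega>) / real (Suc n)) \<longlonglongrightarrow> expectation (X 0)"
    proof (rule tendstoI)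
      fix e :: real assume "0 < e"
      then obtain j where j: "1 / real (Suc j) < e" using nat_approx_posE by blast
      show "\<forall>\<^sub>F n in sequentially. dist ((\<Sum>i<Suc n. X i \<omega>) / real (Suc n)) (expectation (X 0)) < e"
        using *[rule_format, of j] by (rule eventually_mono) (use j in \<open>simp add: dist_real_def\<close>)
    qed
    then show "(\<lambda>n. (\<Sum>i<n. X i \<omega>) / real n) \<longlonglongrightarrow> expectation (X 0)"
      by (rule LIMSEQ_imp_Suc)
  qed
qed

text \<open>The truncated part is bounded. For the tails the maximal inequality controls the
  averages over all sample sizes at once, so the tail is uniformly small in \<open>n\<close> outside
  an event of small probability.\<close>

theorem strong_law_nonneg:
  fixes X :: "nat \<Rightarrow> 'a \<Rightarrow> real"
  assumes indep: "indep_vars (\<lambda>_. borel) X UNIV"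
    and id: "\<And>i. distr M borel (X i) = D"
    and int: "integrable M (X 0)" and nonneg: "\<And>i \<omega>. 0 \<le> X i \<omega>"
  shows "AE \<omega> in M. (\<lambda>n. (\<Sum>i<n. X i \<omega>) / real n) \<longlonglongrightarrow> expectation (X 0)"
proof -
  have X [measurable]: "X i \<in> borel_measurable M" for i
    using indep by (simp add: indep_vars_def)
  define L where "L k i \<omega> = min (X i \<omega>) (real k)" for k i \<omega>
  define T where "T k i \<omega> = X i \<omega> - L k i \<omega>" for k i \<omega>
  have comp: "indep_vars (\<lambda>_. borel) (\<lambda>i \<omega>. h (X i \<omega>)) UNIV"
      "distr M borel (\<lambda>\<omega>. h (X i \<omega>)) = distr D borel h"
    if [measurable]: "h \<in> borel_measurable borel" for h :: "real \<Rightarrow> real" and i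
  proof -
    show "indep_vars (\<lambda>_. borel) (\<lambda>i \<omega>. h (X i \<omega>)) UNIV"
      using indep_vars_compose2[OF indep, of "\<lambda>_. h"] by simp
    have "distr (distr M borel (X i)) borel h = distr M borel (\<lambda>\<omega>. h (X i \<omega>))"
      by (subst distr_distr) (auto simp: comp_def)
    then show "distr M borel (\<lambda>\<omega>. h (X i \<omega>)) = distr D borel h"
      by (simp add: id)
  qed
  have [measurable]: "L k i \<in> borel_measurable M" "T k i \<in> borel_measurable M" for k i
    unfolding T_def L_def by measurable
  have intL: "integrable M (L k 0)" for k
    by (rule Bochner_Integration.integrable_bound[OF int]) (auto simp: L_def nonneg)
  have intT: "integrable M (T k 0)" for k
    unfolding T_def using int intL by simp
  have T_nonneg: "0 \<le> T k i \<omega>" for k i \<omega> by (simp add: T_def L_def)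
  have limT: "(\<lambda>k. expectation (T k 0)) \<longlonglongrightarrow> 0"
  proof -
    have "(\<lambda>k. expectation (T k 0)) \<longlonglongrightarrow> (\<integral>\<omega>. 0 \<partial>M)"
    proof (rule integral_dominated_convergence[where w = "X 0"])
      show "AE \<omega> in M. (\<lambda>k. T k 0 \<omega>) \<longlonglongrightarrow> 0"
      proof (intro AE_I2 tendsto_eventually)
        fix \<omega>
        obtain k0 where "X 0 \<omega> \<le> real k0" using real_arch_simple by blast
        then show "\<forall>\<^sub>F k in sequentially. T k 0 \<omega> = 0"
          by (intro eventually_mono[OF eventually_ge_at_top[of k0]]) (auto simp: T_def L_def)
      qed
      show "AE \<omega> in M. norm (T k 0 \<omega>) \<le> X 0 \<omega>" for k
        using nonneg by (auto simp: T_def L_def)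
    qed (use int in auto)
    then show ?thesis by simp
  qed
  \<comment> \<open>A tail expectation below \<open>(1/4) ^ j\<close>, divided by the level
    \<open>(1/2) ^ j\<close> used in \<open>A j\<close>, leaves the summable bound
    \<open>(1/2) ^ j\<close>.\<close>
  have "\<exists>k. expectation (T k 0) < (1/4) ^ j" for j
    using order_tendstoD(2)[OF limT, of "(1/4) ^ j"] by (auto dest: eventually_happens)
  then obtain K where K: "\<And>j. expectation (T (K j) 0) < (1/4) ^ j" by metis
  define A where "A j = {\<omega>\<in>space M. \<exists>n>0. real n * (1/2) ^ j < (\<Sum>i<n. T (K j) i \<omega>)}" for j :: nat
  have [measurable]: "A j \<in> sets M" for j unfolding A_def by measurable
  have A: "prob (A j) \<le> (1/2) ^ j" for j
  proof -
    have "prob (A j) \<le> expectation (T (K j) 0) / (1/2) ^ j"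
      unfolding A_def
    proof (rule iid_maximal_inequality)
      show "indep_vars (\<lambda>_. borel) (T (K j)) UNIV"
        unfolding T_def L_def using comp(1)[of "\<lambda>x. x - min x (real (K j))"] by simp
      show "distr M borel (T (K j) i) = distr D borel (\<lambda>x. x - min x (real (K j)))" for i
        unfolding T_def L_def using comp(2)[of "\<lambda>x. x - min x (real (K j))"] by simp
    qed (use intT T_nonneg in auto)
    also have "\<dots> \<le> (1/4) ^ j / (1/2) ^ j"
      using K[of j] by (intro divide_right_mono) auto
    also have "\<dots> = (1/2) ^ j" by (simp flip: power_divide)
    finally show ?thesis .
  qed
  have "summable (\<lambda>j. prob (A j))"
    by (rule summable_comparison_test'[where N = 0 and g = "\<lambda>j. (1/2) ^ j"])
       (use A in \<open>auto intro: summable_geometric\<close>)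
  then have BC: "AE \<omega> in M. \<forall>\<^sub>F j in sequentially. \<omega> \<in> space M - A j"
    by (intro borel_cantelli_AE1) (auto simp: emeasure_eq_measure)
  have "AE \<omega> in M. (\<lambda>n. (\<Sum>i<n. L (K j) i \<omega>) / real n) \<longlonglongrightarrow> expectation (L (K j) 0)" for j
  proof (rule strong_law_bounded)
    show "indep_vars (\<lambda>_. borel) (L (K j)) UNIV"
      unfolding L_def using comp(1)[of "\<lambda>x. min x (real (K j))"] by simp
    show "distr M borel (L (K j) i) = distr D borel (\<lambda>x. min x (real (K j)))" for i
      unfolding L_def using comp(2)[of "\<lambda>x. min x (real (K j))"] by simp
    show "L (K j) i \<omega> \<in> {0..real (K j)}" for i \<omega> using nonneg by (simp add: L_def)
  qed
  then have "AE \<omega> in M. \<forall>j. (\<lambda>n. (\<Sum>i<n. L (K j) i \<omega>) / real n) \<longlonglongrightarrow> expectation (L (K j) 0)"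
    by (simp add: AE_all_countable)
  with BC show ?thesis
  proof (eventually_elim, intro tendstoI)
    fix \<omega> and e :: real
    assume ev: "\<forall>\<^sub>F j in sequentially. \<omega> \<in> space M - A j"
      and lim: "\<forall>j. (\<lambda>n. (\<Sum>i<n. L (K j) i \<omega>) / real n) \<longlonglongrightarrow> expectation (L (K j) 0)"
      and e: "0 < e"
    have "(\<lambda>j. (1/2::real) ^ j) \<longlonglongrightarrow> 0" by (rule LIMSEQ_realpow_zero) auto
    then have "\<forall>\<^sub>F j in sequentially. (1/2::real) ^ j < e / 3"
      using e by (intro order_tendstoD) auto
    \<comment> \<open>A single truncation level suffices for given \<open>e\<close>. The three
      thirds go to the truncated average, the tail average and the tail expectation.\<close>
    with ev have "\<exists>j. \<omega> \<in> space M - A j \<and> (1/2::real) ^ j < e / 3"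
      by (intro eventually_happens'[OF sequentially_bot]) (rule eventually_conj)
    then obtain j where j: "\<omega> \<in> space M - A j" "(1/2::real) ^ j < e / 3" by blast
    have Tj: "(\<Sum>i<n. T (K j) i \<omega>) / real n \<le> (1/2) ^ j" if "0 < n" for n
    proof -
      have "\<not> real n * (1/2) ^ j < (\<Sum>i<n. T (K j) i \<omega>)"
        using j(1) that unfolding A_def by blast
      then show ?thesis using that by (simp add: pos_divide_le_eq mult.commute)
    qed
    have "(1/4::real) ^ j \<le> (1/2) ^ j" by (intro power_mono) auto
    then have ET: "0 \<le> expectation (T (K j) 0)" "expectation (T (K j) 0) < e / 3"
      using K[of j] j(2) T_nonneg by auto
    have EX: "expectation (X 0) = expectation (L (K j) 0) + expectation (T (K j) 0)"
      using intL intT by (subst Bochner_Integration.integral_add[symmetric]) (auto simp: T_def)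
    have "\<forall>\<^sub>F n in sequentially. dist ((\<Sum>i<n. L (K j) i \<omega>) / real n) (expectation (L (K j) 0)) < e / 3"
      using lim e by (intro tendstoD) auto
    then show "\<forall>\<^sub>F n in sequentially. dist ((\<Sum>i<n. X i \<omega>) / real n) (expectation (X 0)) < e"
      using eventually_gt_at_top[of 0]
    proof eventually_elim
      case (elim n)
      have "(\<Sum>i<n. X i \<omega>) / real n = (\<Sum>i<n. L (K j) i \<omega>) / real n + (\<Sum>i<n. T (K j) i \<omega>) / real n"
        by (simp add: T_def sum_subtractf diff_divide_distrib)
      moreover have "0 \<le> (\<Sum>i<n. T (K j) i \<omega>) / real n"
        using T_nonneg by (intro divide_nonneg_nonneg sum_nonneg) auto
      ultimately show ?case
        using elim(1) Tj[OF elim(2)] ET EX j(2) unfolding dist_real_def by linarith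
    qed
  qed
qed

end

section \<open>Quantile representation of the empirical risk\<close>

lemma cdf_distributionI: "real_distribution \<mu> \<Longrightarrow> cdf_distribution \<mu>"
  by (simp add: cdf_distribution_def)

lemma quantile_le_iff:
  assumes "real_distribution \<mu>" "0 < u" "u < 1"
  shows "quantile (cdf \<mu>) u \<le> x \<longleftrightarrow> u \<le> cdf \<mu> x"
proof -
  interpret cdf_distribution \<mu> using assms(1) by (rule cdf_distributionI)
  show ?thesis unfolding quantile_def by (rule pseudoinverse[OF assms(2,3), symmetric])
qed

text \<open>For \<open>t \<le> 0\<close> and \<open>t > 1\<close> the infimum is over
  \<open>UNIV\<close> or the empty set, so \<open>quantile\<close> is constant there, whatever its
  default values; the point 1 is a separate piece.\<close>

lemma borel_measurable_quantile:
  assumes "real_distribution \<mu>"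
  shows "quantile (cdf \<mu>) \<in> borel_measurable borel"
proof -
  interpret cdf_distribution \<mu> using assms by (rule cdf_distributionI)
  have const: "f \<in> borel_measurable (restrict_space borel A)"
    if "\<And>x y. x \<in> A \<Longrightarrow> y \<in> A \<Longrightarrow> f x = f y" for f :: "real \<Rightarrow> real" and A
  proof -
    have "\<exists>c. \<forall>x\<in>A. f x = c" using that by blast
    then obtain c where "\<And>x. x \<in> A \<Longrightarrow> f x = c" by blast
    then show ?thesis
      by (subst measurable_cong[where g = "\<lambda>_. c"]) (auto simp: space_restrict_space)
  qed
  have "{s. t \<le> cdf \<mu> s} = UNIV" if "t \<le> 0" for t
    using that cdf_nonneg by (auto intro: order_trans)
  moreover have "{s. t \<le> cdf \<mu> s} = {}" if "1 < t" for t
    using that cdf_bounded_prob by (auto simp: not_le intro: le_less_trans)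
  ultimately have *: "quantile (cdf \<mu>) \<in> borel_measurable (restrict_space borel {..0})"
      "quantile (cdf \<mu>) \<in> borel_measurable (restrict_space borel {1<..})"
      "quantile (cdf \<mu>) \<in> borel_measurable (restrict_space borel {1})"
    by (auto simp: quantile_def intro!: const)
  have "quantile (cdf \<mu>) \<in> borel_measurable (restrict_space borel {0<..<1})"
    using measurable_CI by (simp add: quantile_def[abs_def])
  with * have "quantile (cdf \<mu>) \<in> borel_measurable (restrict_space borel A)"
    if "A \<in> {{..0}, {0<..<1}, {1}, {1<..}}" for A
    using that by blast
  then show ?thesis
  proof (rule measurable_piecewise_restrict[of "{{..0}, {0<..<1}, {1}, {1<..}}", rotated 3])
    show "space borel \<subseteq> \<Union> {{..0}, {0<..<1}, {1}, {1::real<..}}" by force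
  qed auto
qed

lemma uniform01_measurable: "uniform01 P G \<Longrightarrow> G \<in> borel_measurable P"
  by (simp add: uniform01_def)

lemma AE_uniform01:
  assumes G: "uniform01 P G" and AE: "AE x in lborel. x \<in> {0..1} \<longrightarrow> Q x"
  shows "AE \<omega> in P. Q (G \<omega>)"
proof -
  have eq: "distr P lborel G = uniform_measure lborel {0..1}"
    using G by (simp add: uniform01_def)
  have "AE x in distr P lborel G. Q x"
    unfolding eq using AE by (subst AE_uniform_measure) auto
  then show ?thesis
    using uniform01_measurable[OF G] by (intro AE_distrD[of G P lborel]) auto
qed

text \<open>Removes the arguments at which \<open>quantile\<close> is a default value, and a set
  \<open>D\<close> that later holds the discontinuities of the limiting quantile function.\<close>

lemma AE_uniform01_avoids:
  assumes "uniform01 P G" "countable D"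
  shows "AE \<omega> in P. 0 < G \<omega> \<and> G \<omega> < 1 \<and> G \<omega> \<notin> D"
proof (rule AE_uniform01[OF assms(1)])
  have "AE x in lborel. x \<notin> insert 0 (insert 1 D)"
    by (rule AE_not_in) (use assms(2) in \<open>auto intro: countable_imp_null_set_lborel\<close>)
  then show "AE x in lborel. x \<in> {0..1} \<longrightarrow> 0 < x \<and> x < 1 \<and> x \<notin> (D :: real set)"
    by (rule AE_mp) (auto intro!: AE_I2)
qed

text \<open>Inverse transform sampling. The closed interval of \<open>uniform01\<close> and the open
  one on which quantiles are meaningful differ by a null set.\<close>

lemma distr_quantile_uniform01:
  assumes \<mu>: "real_distribution \<mu>" and G: "uniform01 P G"
  shows "distr P borel (\<lambda>\<omega>. quantile (cdf \<mu>) (G \<omega>)) = \<mu>"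
proof -
  interpret cdf_distribution \<mu> using \<mu> by (rule cdf_distributionI)
  note [measurable] = borel_measurable_quantile[OF \<mu>] uniform01_measurable[OF G]
  let ?q = "quantile (cdf \<mu>)"
  have "distr P borel (\<lambda>\<omega>. ?q (G \<omega>)) = distr (distr P lborel G) borel ?q"
    by (subst distr_distr) (auto simp: comp_def)
  also have "\<dots> = distr (uniform_measure lborel {0..1}) borel ?q"
    using G by (simp add: uniform01_def)
  also have "\<dots> = distr (restrict_space lborel {0<..<1::real}) borel ?q"
  proof (rule measure_eqI)
    fix A assume "A \<in> sets (distr (uniform_measure lborel {0..1}) borel ?q)"
    then have A [measurable]: "A \<in> sets borel" by simp
    have m: "?q \<in> borel_measurable (restrict_space lborel {0<..<1})"
      by (rule measurable_restrict_space1) simp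
    have "emeasure (distr (uniform_measure lborel {0..1}) borel ?q) A
        = emeasure (uniform_measure lborel {0..1}) (?q -` A)"
    proof (subst emeasure_distr)
      show "?q \<in> uniform_measure lborel {0..1} \<rightarrow>\<^sub>M borel"
        by (subst measurable_cong_sets[where M' = borel and N' = borel]) auto
    qed auto
    also have "\<dots> = emeasure lborel ({0..1} \<inter> ?q -` A)"
      using measurable_sets[OF borel_measurable_quantile[OF \<mu>] A]
      by (subst emeasure_uniform_measure) (auto simp: divide_ennreal_def)
    also have "\<dots> = emeasure lborel (?q -` A \<inter> {0<..<1})"
    proof (rule emeasure_eq_AE)
      show "AE x in lborel. x \<in> {0..1} \<inter> ?q -` A \<longleftrightarrow> x \<in> ?q -` A \<inter> {0<..<1}"
        using AE_lborel_singleton[of "0::real"] AE_lborel_singleton[of "1::real"]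
        by eventually_elim auto
    qed (use measurable_sets[OF borel_measurable_quantile[OF \<mu>] A] in auto)
    also have "\<dots> = emeasure (distr (restrict_space lborel {0<..<1::real}) borel ?q) A"
      using m by (subst emeasure_distr) (auto simp: emeasure_restrict_space space_restrict_space)
    finally show "emeasure (distr (uniform_measure lborel {0..1}) borel ?q) A
        = emeasure (distr (restrict_space lborel {0<..<1::real}) borel ?q) A" .
  qed simp
  also have "\<dots> = \<mu>"
    using distr_I_eq_M by (simp add: quantile_def[abs_def])
  finally show ?thesis .
qed

lemma quantile_uniform01_Lp:
  assumes \<mu>: "real_distribution \<mu>" and G: "uniform01 P G"
    and int: "integrable \<mu> (\<lambda>x. \<bar>x\<bar> powr p)"
  shows "(\<lambda>\<omega>. quantile (cdf \<mu>) (G \<omega>)) \<in> Lp P p"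
    and "(\<integral>\<omega>. \<bar>quantile (cdf \<mu>) (G \<omega>)\<bar> powr p \<partial>P) = (\<integral>x. \<bar>x\<bar> powr p \<partial>\<mu>)"
proof -
  note [measurable] = borel_measurable_quantile[OF \<mu>] uniform01_measurable[OF G]
  have m [measurable]: "(\<lambda>\<omega>. quantile (cdf \<mu>) (G \<omega>)) \<in> borel_measurable P" by measurable
  have "integrable (distr P borel (\<lambda>\<omega>. quantile (cdf \<mu>) (G \<omega>))) (\<lambda>x. \<bar>x\<bar> powr p)"
    using int by (simp add: distr_quantile_uniform01[OF \<mu> G])
  then show "(\<lambda>\<omega>. quantile (cdf \<mu>) (G \<omega>)) \<in> Lp P p"
    by (subst (asm) integrable_distr_eq) (auto simp: Lp_def)
  have "(\<integral>x. \<bar>x\<bar> powr p \<partial>distr P borel (\<lambda>\<omega>. quantile (cdf \<mu>) (G \<omega>)))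
      = (\<integral>\<omega>. \<bar>quantile (cdf \<mu>) (G \<omega>)\<bar> powr p \<partial>P)"
    by (rule integral_distr) auto
  then show "(\<integral>\<omega>. \<bar>quantile (cdf \<mu>) (G \<omega>)\<bar> powr p \<partial>P) = (\<integral>x. \<bar>x\<bar> powr p \<partial>\<mu>)"
    by (simp add: distr_quantile_uniform01[OF \<mu> G])
qed

text \<open>Through \<open>quantile_le_iff\<close>, bounds on quantiles become bounds on
  distribution functions at a point of choice, and a rational one always fits into the gap. Hence
  convergence at rationals is enough.\<close>

lemma quantile_tendsto:
  assumes \<mu>: "\<And>n. real_distribution (\<mu> n)" and M: "real_distribution M"
    and lim: "\<And>t. t \<in> \<rat> \<Longrightarrow> (\<lambda>n. cdf (\<mu> n) t) \<longlonglongrightarrow> cdf M t"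
    and u: "0 < u" "u < 1" "isCont (quantile (cdf M)) u"
  shows "(\<lambda>n. quantile (cdf (\<mu> n)) u) \<longlonglongrightarrow> quantile (cdf M) u"
proof (rule order_tendstoI)
  fix a assume "a < quantile (cdf M) u"
  then obtain s where s: "s \<in> \<rat>" "a < s" "s < quantile (cdf M) u"
    using Rats_dense_in_real by blast
  then have "cdf M s < u"
    using quantile_le_iff[OF M u(1,2), of s] by simp
  from order_tendstoD(2)[OF lim[OF s(1)] this]
  show "\<forall>\<^sub>F n in sequentially. a < quantile (cdf (\<mu> n)) u"
  proof eventually_elim
    case (elim n)
    then have "s < quantile (cdf (\<mu> n)) u"
      using quantile_le_iff[OF \<mu> u(1,2), of n s] by simp
    then show ?case using s by simp
  qed
next
  fix b assume b: "quantile (cdf M) u < b"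
  \<comment> \<open>The upper bound needs the strict inequality \<open>u < cdf M s\<close>.
    Continuity at \<open>u\<close> supplies a slightly larger \<open>u'\<close> whose quantile is
    still below \<open>b\<close>.\<close>
  have "(quantile (cdf M) \<longlongrightarrow> quantile (cdf M) u) (at_right u)"
    using u(3) by (auto simp: continuous_at intro: tendsto_within_subset)
  from order_tendstoD(2)[OF this b] have "\<forall>\<^sub>F x in at_right u. quantile (cdf M) x < b" .
  moreover have "\<forall>\<^sub>F x in at_right u. x < 1"
    unfolding eventually_at_right[OF u(2)] using u(2) by auto
  moreover have "\<forall>\<^sub>F x in at_right u. u < x"
    by (rule eventually_at_right_less)
  ultimately have "\<forall>\<^sub>F x in at_right u. quantile (cdf M) x < b \<and> x < 1 \<and> u < x"
    by eventually_elim simp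
  then obtain u' where u': "quantile (cdf M) u' < b" "u' < 1" "u < u'"
    using eventually_happens'[OF trivial_limit_at_right_real] by blast
  obtain s where s: "s \<in> \<rat>" "quantile (cdf M) u' < s" "s < b"
    using Rats_dense_in_real[OF u'(1)] by blast
  have "u' \<le> cdf M s"
    using quantile_le_iff[OF M, of u' s] s u u' by simp
  then have "u < cdf M s" using u' by simp
  from order_tendstoD(1)[OF lim[OF s(1)] this]
  show "\<forall>\<^sub>F n in sequentially. quantile (cdf (\<mu> n)) u < b"
  proof eventually_elim
    case (elim n)
    then have "quantile (cdf (\<mu> n)) u \<le> s"
      using quantile_le_iff[OF \<mu> u(1,2), of n s] by simp
    then show ?case using s by simp
  qed
qed

lemma countable_discontinuities_quantile:
  assumes "real_distribution M"
  shows "countable {u\<in>{0<..<1}. \<not> isCont (quantile (cdf M)) u}"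
proof -
  interpret cdf_distribution M using assms by (rule cdf_distributionI)
  have eq: "quantile (cdf M) = I" by (rule ext) (rule quantile_def)
  show ?thesis
    unfolding eq by (rule mono_on_ctble_discont_open[OF open_greaterThanLessThan mono_I])
qed

text \<open>All quantile functions are evaluated at the same \<open>G\<close>, so they converge
  almost everywhere, and the moment condition turns this into convergence in
  \<open>L^p\<close>.\<close>

theorem risk_of_cdf_tendsto:
  assumes \<rho>: "convex_risk_measure P p \<rho>" and p: "0 < p" and G: "uniform01 P G"
    and \<mu>: "\<And>n. real_distribution (\<mu> n)" and M: "real_distribution M"
    and int\<mu>: "\<And>n. integrable (\<mu> n) (\<lambda>x. \<bar>x\<bar> powr p)"
    and intM: "integrable M (\<lambda>x. \<bar>x\<bar> powr p)"
    and lim: "\<And>t. t \<in> \<rat> \<Longrightarrow> (\<lambda>n. cdf (\<mu> n) t) \<longlonglongrightarrow> cdf M t"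
    and mom: "(\<lambda>n. \<integral>x. \<bar>x\<bar> powr p \<partial>\<mu> n) \<longlonglongrightarrow> (\<integral>x. \<bar>x\<bar> powr p \<partial>M)"
  shows "(\<lambda>n. risk_of_cdf \<rho> G (cdf (\<mu> n))) \<longlonglongrightarrow> risk_of_cdf \<rho> G (cdf M)"
  unfolding risk_of_cdf_def
proof (rule convex_risk_measure_tendsto[OF \<rho> p])
  note L\<mu> = quantile_uniform01_Lp[OF \<mu> G int\<mu>]
  note LM = quantile_uniform01_Lp[OF M G intM]
  show "(\<lambda>\<omega>. quantile (cdf (\<mu> n)) (G \<omega>)) \<in> Lp P p" for n by (rule L\<mu>)
  show "(\<lambda>\<omega>. quantile (cdf M) (G \<omega>)) \<in> Lp P p" by (rule LM)
  show "(\<lambda>n. \<integral>\<omega>. \<bar>quantile (cdf (\<mu> n)) (G \<omega>) - quantile (cdf M) (G \<omega>)\<bar> powr p \<partial>P) \<longlonglongrightarrow> 0"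
  proof (rule Lp_tendsto_Scheffe[OF p L\<mu>(1) LM(1)])
    show "AE \<omega> in P. (\<lambda>n. quantile (cdf (\<mu> n)) (G \<omega>)) \<longlonglongrightarrow> quantile (cdf M) (G \<omega>)"
      using AE_uniform01_avoids[OF G countable_discontinuities_quantile[OF M]]
    proof eventually_elim
      case (elim \<omega>)
      then show ?case by (intro quantile_tendsto[OF \<mu> M lim]) auto
    qed
    show "(\<lambda>n. \<integral>\<omega>. \<bar>quantile (cdf (\<mu> n)) (G \<omega>)\<bar> powr p \<partial>P) \<longlonglongrightarrow>
        (\<integral>\<omega>. \<bar>quantile (cdf M) (G \<omega>)\<bar> powr p \<partial>P)"
      using mom by (simp add: L\<mu>(2) LM(2))
  qed
qed

text \<open>The only place where law invariance enters: \<open>X\<close> and its quantile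
  representation have the same distribution.\<close>

lemma risk_of_cdf_distr:
  assumes "prob_space P" and inv: "law_invariant P p \<rho>" and G: "uniform01 P G" and X: "X \<in> Lp P p"
  shows "risk_of_cdf \<rho> G (cdf (distr P borel X)) = \<rho> X"
proof -
  interpret prob_space P by fact
  note [measurable] = LpD(1)[OF X]
  have M: "real_distribution (distr P borel X)"
    by (rule real_distribution_distr) simp
  note [measurable] = borel_measurable_quantile[OF M] uniform01_measurable[OF G]
  let ?q = "\<lambda>\<omega>. quantile (cdf (distr P borel X)) (G \<omega>)"
  have "integrable (distr P borel X) (\<lambda>x. \<bar>x\<bar> powr p)"
    using LpD(2)[OF X] by (subst integrable_distr_eq) auto
  then have q: "?q \<in> Lp P p" by (rule quantile_uniform01_Lp[OF M G])
  have "measure P {\<omega>\<in>space P. Y \<omega> \<le> t} = cdf (distr P borel Y) t"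
    if [measurable]: "Y \<in> borel_measurable P" for Y t
    unfolding cdf_def by (subst measure_distr) (auto intro!: arg_cong[where f = "measure P"])
  then have "measure P {\<omega>\<in>space P. ?q \<omega> \<le> t} = measure P {\<omega>\<in>space P. X \<omega> \<le> t}" for t
    using distr_quantile_uniform01[OF M G] by simp
  then show ?thesis
    unfolding risk_of_cdf_def
    by (intro inv[unfolded law_invariant_def, rule_format, OF q X])
qed

text \<open>Image of the uniform law on the indices, so that sample averages are integrals. At
  \<open>N = 0\<close> it is still some probability measure, but an unspecified one, whence the
  assumption \<open>0 < N\<close> below.\<close>

definition empirical_measure :: "(nat \<Rightarrow> real) \<Rightarrow> nat \<Rightarrow> real measure" where
  "empirical_measure v N = distr (measure_pmf (pmf_of_set {1..N})) borel v"

lemma real_distribution_empirical: "real_distribution (empirical_measure v N)"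
  unfolding empirical_measure_def by (rule prob_space.real_distribution_distr[OF measure_pmf.prob_space_axioms]) simp

lemma integral_empirical_measure:
  assumes [measurable]: "k \<in> borel_measurable borel" and N: "0 < N"
  shows "integrable (empirical_measure v N) (k :: real \<Rightarrow> real)"
    and "(\<integral>x. k x \<partial>empirical_measure v N) = (\<Sum>i=1..N. k (v i)) / real N"
proof -
  have "integrable (measure_pmf (pmf_of_set {1..N})) (\<lambda>i. k (v i))"
    using N by (intro integrable_measure_pmf_finite) auto
  then show "integrable (empirical_measure v N) k"
    unfolding empirical_measure_def by (subst integrable_distr_eq) auto
  show "(\<integral>x. k x \<partial>empirical_measure v N) = (\<Sum>i=1..N. k (v i)) / real N"
    unfolding empirical_measure_def using N
    by (subst integral_distr) (auto simp: integral_pmf_of_set)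
qed

lemma cdf_empirical_measure:
  assumes "0 < N"
  shows "cdf (empirical_measure v N) = empirical_cdf v N"
proof
  fix t
  interpret real_distribution "empirical_measure v N" by (rule real_distribution_empirical)
  have "cdf (empirical_measure v N) t = (\<integral>x. indicator {..t} x \<partial>empirical_measure v N)"
    by (simp add: cdf_def)
  also have "\<dots> = empirical_cdf v N t"
    using assms by (subst integral_empirical_measure) (auto simp: empirical_cdf_def)
  finally show "cdf (empirical_measure v N) t = empirical_cdf v N t" .
qed

lemma empirical_quantile_Lp:
  assumes "uniform01 P G" "0 < N"
  shows "(\<lambda>\<omega>. quantile (empirical_cdf v N) (G \<omega>)) \<in> Lp P p"
proof -
  have "integrable (empirical_measure v N) (\<lambda>x. \<bar>x\<bar> powr p)"
    using assms(2) by (intro integral_empirical_measure) auto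
  from quantile_uniform01_Lp(1)[OF real_distribution_empirical assms(1) this] show ?thesis
    unfolding cdf_empirical_measure[OF assms(2)] .
qed

text \<open>Enlarging the sample values lowers the empirical distribution function, and the quantile
  moves the opposite way.\<close>

lemma empirical_quantile_mono:
  assumes N: "0 < N" and u: "0 < u" "u < 1" and le: "\<And>i. i \<in> {1..N} \<Longrightarrow> v i \<le> w i"
  shows "quantile (empirical_cdf v N) u \<le> quantile (empirical_cdf w N) u"
proof -
  note iff = quantile_le_iff[OF real_distribution_empirical u, of _ N, unfolded cdf_empirical_measure[OF N]]
  let ?x = "quantile (empirical_cdf w N) u"
  have "u \<le> empirical_cdf w N ?x" using iff[of w ?x] by simp
  also have "\<dots> \<le> empirical_cdf v N ?x"
    unfolding empirical_cdf_def using le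
    by (intro mult_left_mono sum_mono) (force simp: indicator_def)+
  finally show ?thesis using iff[of v ?x] by simp
qed

lemma empirical_risk_mono:
  assumes \<rho>: "convex_risk_measure P p \<rho>" and G: "uniform01 P G" and N: "0 < N"
    and le: "\<And>i. i \<in> {1..N} \<Longrightarrow> v i \<le> w i"
  shows "risk_of_cdf \<rho> G (empirical_cdf v N) \<le> risk_of_cdf \<rho> G (empirical_cdf w N)"
  unfolding risk_of_cdf_def
proof (rule convex_risk_measure_mono[OF \<rho> empirical_quantile_Lp[OF G N] empirical_quantile_Lp[OF G N]])
  show "AE \<omega> in P. quantile (empirical_cdf v N) (G \<omega>) \<le> quantile (empirical_cdf w N) (G \<omega>)"
    using AE_uniform01_avoids[OF G, of "{}"]
    by (rule AE_mp) (auto intro!: AE_I2 empirical_quantile_mono[OF N _ _ le])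
qed

lemma iid_average_tendsto:
  fixes \<xi>s :: "nat \<Rightarrow> 'v \<Rightarrow> 'x" and h :: "'x \<Rightarrow> real"
  assumes "prob_space M"
    and meas: "\<And>i. 1 \<le> i \<Longrightarrow> \<xi>s i \<in> M \<rightarrow>\<^sub>M PX"
    and law: "\<And>i. 1 \<le> i \<Longrightarrow> distr M PX (\<xi>s i) = PX"
    and indep: "prob_space.indep_vars M (\<lambda>_. PX) \<xi>s {1..}"
    and h: "integrable PX h" and nonneg: "\<And>x. 0 \<le> h x"
  shows "AE \<omega> in M. (\<lambda>n. (\<Sum>i=1..n. h (\<xi>s i \<omega>)) / real n) \<longlonglongrightarrow> (\<integral>x. h x \<partial>PX)"
proof -
  interpret prob_space M by fact
  have [measurable]: "h \<in> borel_measurable PX" using h by auto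
  \<comment> \<open>The sample starts at index 1, the strong law at 0.\<close>
  define X where "X i \<omega> = h (\<xi>s (Suc i) \<omega>)" for i \<omega>
  have "range Suc = {1..}" by (auto simp: image_iff Suc_le_eq gr0_conv_Suc)
  then have "indep_vars (\<lambda>_. PX) (\<lambda>i. \<xi>s (Suc i)) UNIV"
    using indep_vars_reindex[of Suc UNIV "\<lambda>_. PX" \<xi>s] indep by simp
  then have iX: "indep_vars (\<lambda>_. borel) X UNIV"
    unfolding X_def by (rule indep_vars_compose2) simp
  have dX: "distr M borel (X i) = distr PX borel h" for i
  proof -
    have "distr (distr M PX (\<xi>s (Suc i))) borel h = distr M borel (X i)"
      using meas[of "Suc i"] by (subst distr_distr) (auto simp: X_def[abs_def] comp_def)
    then show ?thesis by (simp add: law)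
  qed
  have "integrable (distr M PX (\<xi>s (Suc 0))) h" using h by (simp add: law)
  then have int: "integrable M (X 0)"
    using meas[of "Suc 0"] by (subst (asm) integrable_distr_eq) (auto simp: X_def[abs_def])
  have "(\<integral>x. h x \<partial>distr M PX (\<xi>s (Suc 0))) = expectation (X 0)"
    using meas[of "Suc 0"] unfolding X_def by (intro integral_distr) auto
  then have E: "expectation (X 0) = (\<integral>x. h x \<partial>PX)" by (simp add: law)
  have S: "(\<Sum>i<n. X i \<omega>) = (\<Sum>i=1..n. h (\<xi>s i \<omega>))" for n \<omega>
    unfolding X_def by (rule sum_bounds_lt_plus1)
  have "AE \<omega> in M. (\<lambda>n. (\<Sum>i<n. X i \<omega>) / real n) \<longlonglongrightarrow> expectation (X 0)"
    by (rule strong_law_nonneg[OF iX dX int]) (simp add: X_def nonneg)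
  then show ?thesis by (simp add: S E)
qed

text \<open>The strong law is applied to the countably many indicators of \<open>{..t}\<close> with
  rational \<open>t\<close> and to \<open>\<bar>g\<bar> powr p\<close>. The exceptional null set
  still depends on \<open>g\<close>.\<close>

theorem empirical_risk_tendsto:
  fixes \<xi>s :: "nat \<Rightarrow> 'v \<Rightarrow> 'x" and g :: "'x \<Rightarrow> real"
  assumes P: "prob_space P" and p: "0 < p"
    and \<rho>: "convex_risk_measure P p \<rho>" "law_invariant P p \<rho>" and G: "uniform01 P G"
    and M: "prob_space M"
    and meas: "\<And>i. 1 \<le> i \<Longrightarrow> \<xi>s i \<in> M \<rightarrow>\<^sub>M PX"
    and law: "\<And>i. 1 \<le> i \<Longrightarrow> distr M PX (\<xi>s i) = PX"
    and indep: "prob_space.indep_vars M (\<lambda>_. PX) \<xi>s {1..}"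
    and \<xi>: "\<xi> \<in> P \<rightarrow>\<^sub>M PX" "distr P PX \<xi> = PX"
    and g: "g \<in> Lp PX p"
  shows "AE \<omega> in M. (\<lambda>N. risk_of_cdf \<rho> G (empirical_cdf (\<lambda>i. g (\<xi>s i \<omega>)) N))
           \<longlonglongrightarrow> \<rho> (\<lambda>\<omega>. g (\<xi> \<omega>))"
proof -
  interpret P: prob_space P by fact
  note [measurable] = LpD(1)[OF g] \<xi>(1)
  have PX: "prob_space PX" using P.prob_space_distr[OF \<xi>(1)] \<xi>(2) by simp
  interpret PX: prob_space PX by fact
  let ?X = "\<lambda>\<omega>. g (\<xi> \<omega>)"
  let ?\<mu> = "distr PX borel g"
  have dX: "distr P borel ?X = ?\<mu>"
    using distr_distr[OF LpD(1)[OF g] \<xi>(1)] \<xi>(2) by (simp add: comp_def)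
  have "integrable (distr P PX \<xi>) (\<lambda>x. \<bar>g x\<bar> powr p)" using LpD(2)[OF g] \<xi>(2) by simp
  then have X: "?X \<in> Lp P p"
    by (subst (asm) integrable_distr_eq) (auto simp: Lp_def)
  have r\<mu>: "real_distribution ?\<mu>"
    by (rule PX.real_distribution_distr) simp
  have int\<mu>: "integrable ?\<mu> (\<lambda>x. \<bar>x\<bar> powr p)"
    using LpD(2)[OF g] by (subst integrable_distr_eq) auto
  have avg: "AE \<omega> in M. (\<lambda>n. (\<Sum>i=1..n. h (\<xi>s i \<omega>)) / real n) \<longlonglongrightarrow> (\<integral>x. h x \<partial>PX)"
    if "integrable PX h" "\<And>x. 0 \<le> h x" for h :: "'x \<Rightarrow> real"
    using M meas law indep that by (rule iid_average_tendsto)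
  have "AE \<omega> in M. (\<lambda>n. (\<Sum>i=1..n. indicat_real {..t} (g (\<xi>s i \<omega>))) / real n) \<longlonglongrightarrow> cdf ?\<mu> t" for t
  proof -
    have "(\<integral>x. indicat_real {..t} (g x) \<partial>PX) = (\<integral>x. indicat_real {..t} x \<partial>?\<mu>)"
      by (rule integral_distr[symmetric]) auto
    also have "\<dots> = cdf ?\<mu> t" by (simp add: cdf_def)
    finally have "(\<integral>x. indicat_real {..t} (g x) \<partial>PX) = cdf ?\<mu> t" .
    moreover have "integrable PX (\<lambda>x. indicat_real {..t} (g x))"
      by (rule PX.integrable_const_bound[where B = 1]) (auto simp: indicator_def)
    ultimately show ?thesis using avg[of "\<lambda>x. indicat_real {..t} (g x)"] by simp
  qed
  then have "AE \<omega> in M. \<forall>t\<in>\<rat>. (\<lambda>n. (\<Sum>i=1..n. indicat_real {..t} (g (\<xi>s i \<omega>))) / real n) \<longlonglongrightarrow> cdf ?\<mu> t"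
    by (intro AE_ball_countable[THEN iffD2] countable_rat ballI)
  moreover have "AE \<omega> in M. (\<lambda>n. (\<Sum>i=1..n. \<bar>g (\<xi>s i \<omega>)\<bar> powr p) / real n) \<longlonglongrightarrow> (\<integral>x. \<bar>x\<bar> powr p \<partial>?\<mu>)"
  proof -
    have "(\<integral>x. \<bar>x\<bar> powr p \<partial>?\<mu>) = (\<integral>x. \<bar>g x\<bar> powr p \<partial>PX)"
      by (rule integral_distr) auto
    then show ?thesis using avg[OF LpD(2)[OF g]] by simp
  qed
  ultimately show ?thesis
  proof eventually_elim
    case (elim \<omega>)
    \<comment> \<open>Shifted by one to avoid the empty sample.\<close>
    let ?m = "\<lambda>n. empirical_measure (\<lambda>i. g (\<xi>s i \<omega>)) (Suc n)"
    have "(\<lambda>n. risk_of_cdf \<rho> G (cdf (?m n))) \<longlonglongrightarrow> risk_of_cdf \<rho> G (cdf ?\<mu>)"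
    proof (rule risk_of_cdf_tendsto[OF \<rho>(1) p G real_distribution_empirical r\<mu> _ int\<mu>])
      show "integrable (?m n) (\<lambda>x. \<bar>x\<bar> powr p)" for n
        by (rule integral_empirical_measure) auto
      show "(\<lambda>n. \<integral>x. \<bar>x\<bar> powr p \<partial>?m n) \<longlonglongrightarrow> (\<integral>x. \<bar>x\<bar> powr p \<partial>?\<mu>)"
        using LIMSEQ_Suc[OF elim(2)]
        by (subst integral_empirical_measure) (auto simp del: sum.cl_ivl_Suc of_nat_Suc)
      show "(\<lambda>n. cdf (?m n) t) \<longlonglongrightarrow> cdf ?\<mu> t" if "t \<in> \<rat>" for t
        using LIMSEQ_Suc[OF elim(1)[rule_format, OF that]]
        by (simp add: cdf_empirical_measure empirical_cdf_def del: sum.cl_ivl_Suc of_nat_Suc)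
    qed
    then have "(\<lambda>n. risk_of_cdf \<rho> G (empirical_cdf (\<lambda>i. g (\<xi>s i \<omega>)) (Suc n))) \<longlonglongrightarrow> \<rho> ?X"
      using risk_of_cdf_distr[OF P \<rho>(2) G X] by (simp add: cdf_empirical_measure dX)
    then show ?case by (rule LIMSEQ_imp_Suc)
  qed
qed

section \<open>Lower envelopes and convergence of minimization problems\<close>

text \<open>By continuity in \<open>y\<close>, the infimum over \<open>T\<close> equals that over a
  countable dense subset.\<close>

lemma caratheodory_INF_measurable:
  fixes f :: "'y::{metric_space, second_countable_topology} \<Rightarrow> 'x \<Rightarrow> real"
  assumes f: "caratheodory M S f" and T: "T \<subseteq> S" "T \<noteq> {}"
    and bdd: "\<And>x. x \<in> space M \<Longrightarrow> bdd_below ((\<lambda>y. f y x) ` T)"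
  shows "(\<lambda>x. INF y\<in>T. f y x) \<in> borel_measurable M"
proof -
  obtain D where D: "countable D" "D \<subseteq> T" "T \<subseteq> closure D"
    by (rule separable)
  have Dne: "D \<noteq> {}" using D(3) T(2) by auto
  have eq: "(INF y\<in>T. f y x) = (INF y\<in>D. f y x)" if x: "x \<in> space M" for x
  proof (rule antisym)
    show "(INF y\<in>T. f y x) \<le> (INF y\<in>D. f y x)"
      using D Dne bdd[OF x] by (intro cINF_superset_mono) auto
    have bddD: "bdd_below ((\<lambda>y. f y x) ` D)"
      using bdd[OF x] D(2) by (meson bdd_below_mono image_mono)
    show "(INF y\<in>D. f y x) \<le> (INF y\<in>T. f y x)"
    proof (rule cINF_greatest[OF T(2)], rule field_le_epsilon)
      fix y and e :: real assume y: "y \<in> T" and e: "0 < e"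
      have "continuous_on S (\<lambda>y. f y x)" using f x by (simp add: caratheodory_def)
      then obtain d where d: "0 < d" "\<And>y'. y' \<in> S \<Longrightarrow> dist y' y < d \<Longrightarrow> dist (f y' x) (f y x) < e"
        using y T(1) e unfolding continuous_on_iff by (metis subsetD)
      obtain y' where y': "y' \<in> D" "dist y' y < d"
        using D(3) y d(1) closure_approachable by blast
      have "(INF y\<in>D. f y x) \<le> f y' x" using bddD y'(1) by (rule cINF_lower)
      also have "f y' x \<le> f y x + e"
        using d(2)[of y'] y' D(2) T(1) by (force simp: dist_real_def)
      finally show "(INF y\<in>D. f y x) \<le> f y x + e" .
    qed
  qed
  have "(\<lambda>x. INF y\<in>D. f y x) \<in> borel_measurable M"
    using D T(1) f by (intro borel_measurable_cINF_real) (auto simp: caratheodory_def)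
  then show ?thesis
    using eq by (subst measurable_cong[where g = "\<lambda>x. INF y\<in>D. f y x"]) auto
qed

lemma Lp_compose_law:
  assumes \<xi>: "\<xi> \<in> P \<rightarrow>\<^sub>M PX" "distr P PX \<xi> = PX" and g: "g \<in> Lp PX p"
  shows "(\<lambda>\<omega>. g (\<xi> \<omega>)) \<in> Lp P p"
    and "(\<integral>\<omega>. \<bar>g (\<xi> \<omega>)\<bar> powr p \<partial>P) = (\<integral>x. \<bar>g x\<bar> powr p \<partial>PX)"
proof -
  note [measurable] = \<xi>(1) LpD(1)[OF g]
  have "integrable (distr P PX \<xi>) (\<lambda>x. \<bar>g x\<bar> powr p)" using LpD(2)[OF g] \<xi>(2) by simp
  then show "(\<lambda>\<omega>. g (\<xi> \<omega>)) \<in> Lp P p"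
    by (subst (asm) integrable_distr_eq) (auto simp: Lp_def)
  have "(\<integral>x. \<bar>g x\<bar> powr p \<partial>distr P PX \<xi>) = (\<integral>\<omega>. \<bar>g (\<xi> \<omega>)\<bar> powr p \<partial>P)"
    by (rule integral_distr) measurable
  then show "(\<integral>\<omega>. \<bar>g (\<xi> \<omega>)\<bar> powr p \<partial>P) = (\<integral>x. \<bar>g x\<bar> powr p \<partial>PX)"
    using \<xi>(2) by simp
qed

text \<open>The envelopes over balls shrinking to \<open>y0\<close> tend pointwise to
  \<open>f y0\<close> by continuity. They lie between \<open>h\<close> and \<open>f y0\<close>, so
  \<open>f y0 - h\<close> dominates the difference, the convergence holds in \<open>L^p\<close>, and
  \<open>\<rho>\<close> is continuous there.\<close>

lemma risk_lower_envelope: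
  fixes f :: "'y::{metric_space, second_countable_topology} \<Rightarrow> 'x \<Rightarrow> real"
  assumes p: "0 < p" and \<rho>: "convex_risk_measure P p \<rho>"
    and \<xi>: "\<xi> \<in> P \<rightarrow>\<^sub>M PX" "distr P PX \<xi> = PX"
    and f: "caratheodory PX S f" and y0: "y0 \<in> S" and fy0: "f y0 \<in> Lp PX p"
    and V: "openin (top_of_set S) V" "y0 \<in> V" and h: "h \<in> Lp PX p"
    and hf: "\<And>y x. y \<in> V \<Longrightarrow> x \<in> space PX \<Longrightarrow> h x \<le> f y x" and \<epsilon>: "0 < \<epsilon>"
  shows "\<exists>d>0. \<exists>g\<in>Lp PX p. (\<forall>y\<in>S \<inter> ball y0 d. \<forall>x\<in>space PX. g x \<le> f y x) \<and>
           \<rho> (\<lambda>\<omega>. f y0 (\<xi> \<omega>)) - \<epsilon> < \<rho> (\<lambda>\<omega>. g (\<xi> \<omega>))"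
proof -
  obtain d0 where d0: "0 < d0" "ball y0 d0 \<inter> S \<subseteq> V"
    using V unfolding openin_contains_ball by blast
  \<comment> \<open>The cap \<open>d0\<close> keeps every ball inside \<open>V\<close>, where
    \<open>h\<close> is a minorant.\<close>
  define d where "d k = min d0 (1 / real (Suc k))" for k
  have d: "0 < d k" for k using d0 by (simp add: d_def)
  define T where "T k = S \<inter> ball y0 (d k)" for k
  have TV: "T k \<subseteq> V" for k using d0(2) by (auto simp: T_def d_def)
  have y0T: "y0 \<in> T k" for k using y0 d by (simp add: T_def)
  define g where "g k x = (INF y\<in>T k. f y x)" for k x
  have bdd: "bdd_below ((\<lambda>y. f y x) ` T k)" if "x \<in> space PX" for x k
    using hf[OF _ that] TV[of k] by (intro bdd_belowI[of _ "h x"]) auto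
  have g_le: "g k x \<le> f y x" if "x \<in> space PX" "y \<in> T k" for k x y
    unfolding g_def using bdd[OF that(1)] that(2) by (rule cINF_lower)
  have h_le: "h x \<le> g k x" if "x \<in> space PX" for k x
    unfolding g_def
  proof (rule cINF_greatest)
    show "T k \<noteq> {}" using y0T[of k] by blast
    show "h x \<le> f y x" if "y \<in> T k" for y using hf[OF _ \<open>x \<in> space PX\<close>] TV[of k] that by blast
  qed
  have g_meas [measurable]: "g k \<in> borel_measurable PX" for k
    unfolding g_def[abs_def]
  proof (rule caratheodory_INF_measurable[OF f])
    show "T k \<subseteq> S" by (simp add: T_def)
    show "T k \<noteq> {}" using y0T[of k] by blast
  qed (rule bdd)
  have fh: "(\<lambda>x. f y0 x - h x) \<in> Lp PX p" using fy0 h p by (intro Lp_diff) auto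
  note [measurable] = LpD(1)[OF fy0] LpD(1)[OF fh]
  have diff_le: "\<bar>g k x - f y0 x\<bar> \<le> \<bar>f y0 x - h x\<bar>" if "x \<in> space PX" for k x
    using g_le[OF that y0T[of k]] h_le[OF that, of k] by linarith
  have gf: "(\<lambda>x. g k x - f y0 x) \<in> Lp PX p" for k
    by (rule Lp_dominated[OF fh]) (use diff_le p in auto)
  have gLp: "g k \<in> Lp PX p" for k
    using Lp_add[OF gf fy0] p by simp
  have lim: "(\<lambda>k. g k x) \<longlonglongrightarrow> f y0 x" if x: "x \<in> space PX" for x
  proof (rule LIMSEQ_I)
    fix e :: real assume e: "0 < e"
    have "continuous_on S (\<lambda>y. f y x)" using f x by (simp add: caratheodory_def)
    then obtain \<eta> where \<eta>: "0 < \<eta>" "\<And>y'. y' \<in> S \<Longrightarrow> dist y' y0 < \<eta> \<Longrightarrow> dist (f y' x) (f y0 x) < e / 2"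
      using y0 half_gt_zero[OF e] unfolding continuous_on_iff by metis
    obtain K where K: "1 / real (Suc K) < \<eta>" using \<eta>(1) nat_approx_posE by blast
    have "norm (g k x - f y0 x) < e" if k: "K \<le> k" for k
    proof -
      have "1 / real (Suc k) \<le> 1 / real (Suc K)" using k by (simp add: frac_le)
      then have dk: "d k < \<eta>" using K by (simp add: d_def)
      have "f y0 x - e / 2 \<le> g k x"
        unfolding g_def
      proof (rule cINF_greatest)
        fix y assume "y \<in> T k"
        then have "dist (f y x) (f y0 x) < e / 2"
          using dk by (intro \<eta>(2)) (auto simp: T_def dist_commute)
        then show "f y0 x - e / 2 \<le> f y x" unfolding dist_real_def by linarith
      qed (use y0T in auto)
      then show ?thesis using g_le[OF x y0T[of k]] e by simp
    qed
    then show "\<exists>K. \<forall>k\<ge>K. norm (g k x - f y0 x) < e" by blast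
  qed
  have "(\<lambda>k. \<integral>x. \<bar>g k x - f y0 x\<bar> powr p \<partial>PX) \<longlonglongrightarrow> (\<integral>x. 0 \<partial>PX)"
  proof (rule integral_dominated_convergence[where w = "\<lambda>x. \<bar>f y0 x - h x\<bar> powr p"])
    show "AE x in PX. (\<lambda>k. \<bar>g k x - f y0 x\<bar> powr p) \<longlonglongrightarrow> 0"
    proof (intro AE_I2)
      fix x assume "x \<in> space PX"
      from lim[OF this] have "(\<lambda>k. \<bar>g k x - f y0 x\<bar> powr p) \<longlonglongrightarrow> \<bar>f y0 x - f y0 x\<bar> powr p"
        using p by (intro tendsto_powr' tendsto_rabs tendsto_diff tendsto_const) auto
      then show "(\<lambda>k. \<bar>g k x - f y0 x\<bar> powr p) \<longlonglongrightarrow> 0" using p by simp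
    qed
    show "AE x in PX. norm (\<bar>g k x - f y0 x\<bar> powr p) \<le> \<bar>f y0 x - h x\<bar> powr p" for k
      using diff_le p by (intro AE_I2) (auto intro: powr_mono2)
    show "integrable PX (\<lambda>x. \<bar>f y0 x - h x\<bar> powr p)" by (rule LpD(2)[OF fh])
  qed measurable
  then have "(\<lambda>k. \<integral>\<omega>. \<bar>g k (\<xi> \<omega>) - f y0 (\<xi> \<omega>)\<bar> powr p \<partial>P) \<longlonglongrightarrow> 0"
    using Lp_compose_law(2)[OF \<xi> gf] by simp
  then have "(\<lambda>k. \<rho> (\<lambda>\<omega>. g k (\<xi> \<omega>))) \<longlonglongrightarrow> \<rho> (\<lambda>\<omega>. f y0 (\<xi> \<omega>))"
    by (intro convex_risk_measure_tendsto[OF \<rho> p] Lp_compose_law(1)[OF \<xi>] gLp fy0)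
  then have "\<forall>\<^sub>F k in sequentially. \<rho> (\<lambda>\<omega>. f y0 (\<xi> \<omega>)) - \<epsilon> < \<rho> (\<lambda>\<omega>. g k (\<xi> \<omega>))"
    using \<epsilon> by (intro order_tendstoD(1)) auto
  then obtain k where k: "\<rho> (\<lambda>\<omega>. f y0 (\<xi> \<omega>)) - \<epsilon> < \<rho> (\<lambda>\<omega>. g k (\<xi> \<omega>))"
    by (auto dest: eventually_happens)
  have "\<forall>y\<in>S \<inter> ball y0 (d k). \<forall>x\<in>space PX. g k x \<le> f y x"
    using g_le[where k = k] by (auto simp: T_def)
  then show ?thesis using k d[of k] gLp[of k] by blast
qed

lemma continuous_on_risk:
  assumes p: "0 < p" and \<rho>: "convex_risk_measure P p \<rho>" and F: "continuous_into_Lp P p S F"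
  shows "continuous_on (S :: 'y::metric_space set) (\<lambda>y. \<rho> (F y))"
  unfolding continuous_on_eq_continuous_within
proof (intro ballI continuous_within_sequentiallyI)
  fix y and u :: "nat \<Rightarrow> 'y"
  assume y: "y \<in> S" and u: "u \<longlonglongrightarrow> y" "\<forall>n. u n \<in> S"
  let ?L = "\<lambda>x. Lp_norm P p (\<lambda>\<omega>. F x \<omega> - F y \<omega>)"
  have L0: "?L y = 0" using p by (simp add: Lp_norm_def)
  have "continuous (at y within S) ?L"
    using F y L0 by (simp add: continuous_within continuous_into_Lp_def)
  then have "(\<lambda>n. ?L (u n)) \<longlonglongrightarrow> ?L y"
    using u by (intro continuous_within_tendsto_compose'[where S = S and f = ?L]) auto
  then have "(\<lambda>n. ?L (u n) powr p) \<longlonglongrightarrow> 0 powr p"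
    unfolding L0 using p by (intro tendsto_powr') (auto simp: Lp_norm_def)
  moreover have "?L x powr p = (\<integral>\<omega>. \<bar>F x \<omega> - F y \<omega>\<bar> powr p \<partial>P)" for x
    using p by (simp add: Lp_norm_def powr_powr)
  ultimately have "(\<lambda>n. \<integral>\<omega>. \<bar>F (u n) \<omega> - F y \<omega>\<bar> powr p \<partial>P) \<longlonglongrightarrow> 0" using p by simp
  then show "(\<lambda>n. \<rho> (F (u n))) \<longlonglongrightarrow> \<rho> (F y)"
    using F u y by (intro convex_risk_measure_tendsto[OF \<rho> p]) (auto simp: continuous_into_Lp_def)
qed

text \<open>The lower half of continuous convergence: it yields a lower limit of at least
  \<open>\<phi> y\<close> along any points of \<open>S\<close> tending to \<open>y\<close>. The
  neighbourhood is independent of \<open>N\<close>.\<close>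

definition locally_liminf_ge ::
    "'y::topological_space set \<Rightarrow> (nat \<Rightarrow> 'y \<Rightarrow> real) \<Rightarrow> ('y \<Rightarrow> real) \<Rightarrow> bool" where
  "locally_liminf_ge S \<phi>N \<phi> \<longleftrightarrow> (\<forall>y\<in>S. \<forall>\<epsilon>>0. \<exists>U. open U \<and> y \<in> U \<and>
     (\<forall>\<^sub>F N in sequentially. \<forall>y'\<in>S \<inter> U. \<phi> y - \<epsilon> \<le> \<phi>N N y'))"

theorem empirical_risk_locally_liminf_ge:
  fixes f :: "'y::{metric_space, second_countable_topology} \<Rightarrow> 'x \<Rightarrow> real"
  assumes P: "prob_space P" and p: "0 < p"
    and \<rho>: "convex_risk_measure P p \<rho>" "law_invariant P p \<rho>" and G: "uniform01 P G"
    and M: "prob_space M"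
    and meas: "\<And>i. 1 \<le> i \<Longrightarrow> \<xi>s i \<in> M \<rightarrow>\<^sub>M PX"
    and law: "\<And>i. 1 \<le> i \<Longrightarrow> distr M PX (\<xi>s i) = PX"
    and indep: "prob_space.indep_vars M (\<lambda>_. PX) \<xi>s {1..}"
    and \<xi>: "\<xi> \<in> P \<rightarrow>\<^sub>M PX" "distr P PX \<xi> = PX"
    and f: "caratheodory PX S f" and fLp: "\<And>y. y \<in> S \<Longrightarrow> f y \<in> Lp PX p"
    and F: "continuous_into_Lp P p S (\<lambda>y \<omega>. f y (\<xi> \<omega>))"
    and lb: "\<And>y. y \<in> S \<Longrightarrow> \<exists>V h. openin (top_of_set S) V \<and> y \<in> V \<and> h \<in> Lp PX p \<and>
           (\<forall>y'\<in>V. \<forall>x\<in>space PX. h x \<le> f y' x)"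
  shows "AE \<omega> in M. locally_liminf_ge S
           (\<lambda>N y. risk_of_cdf \<rho> G (empirical_cdf (\<lambda>i. f y (\<xi>s i \<omega>)) N)) (\<lambda>y. \<rho> (\<lambda>\<omega>. f y (\<xi> \<omega>)))"
proof -
  let ?\<phi> = "\<lambda>y. \<rho> (\<lambda>\<omega>. f y (\<xi> \<omega>))"
  define e where "e j = 1 / real (Suc j)" for j
  have e: "0 < e j" for j by (simp add: e_def)
  have cont: "continuous_on S ?\<phi>" by (rule continuous_on_risk[OF p \<rho>(1) F])
  \<comment> \<open>The last conjunct is present because the claim concerns \<open>?\<phi> y\<close>
    at the given point, whereas the envelope is built at the centre \<open>c\<close>.\<close>
  define Q where "Q c j d g \<longleftrightarrow> 0 < d \<and> g \<in> Lp PX p \<and>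
      (\<forall>y\<in>S \<inter> ball c d. \<forall>x\<in>space PX. g x \<le> f y x) \<and>
      ?\<phi> c - e j < \<rho> (\<lambda>\<omega>. g (\<xi> \<omega>)) \<and> (\<forall>y\<in>S \<inter> ball c d. ?\<phi> y < ?\<phi> c + e j)" for c j d g
  have ex: "\<exists>d g. Q c j d g" if c: "c \<in> S" for c j
  proof -
    obtain V h where "openin (top_of_set S) V" "c \<in> V" "h \<in> Lp PX p"
        "\<And>y x. y \<in> V \<Longrightarrow> x \<in> space PX \<Longrightarrow> h x \<le> f y x"
      using lb[OF c] by blast
    from risk_lower_envelope[OF p \<rho>(1) \<xi> f c fLp[OF c] this e[of j]]
    obtain d g where d: "0 < d" and g: "g \<in> Lp PX p" "\<And>y x. y \<in> S \<inter> ball c d \<Longrightarrow> x \<in> space PX \<Longrightarrow> g x \<le> f y x"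
        "?\<phi> c - e j < \<rho> (\<lambda>\<omega>. g (\<xi> \<omega>))"
      by blast
    obtain d' where d': "0 < d'" "\<And>y. y \<in> S \<Longrightarrow> dist y c < d' \<Longrightarrow> dist (?\<phi> y) (?\<phi> c) < e j"
      using cont c e[of j] unfolding continuous_on_iff by metis
    have "?\<phi> y < ?\<phi> c + e j" if "y \<in> S \<inter> ball c (min d d')" for y
      using d'(2)[of y] that by (auto simp: dist_real_def dist_commute)
    then have "Q c j (min d d') g"
      unfolding Q_def using d d'(1) g by auto
    then show ?thesis by blast
  qed
  obtain d g where dg: "\<And>c j. c \<in> S \<Longrightarrow> Q c j (d c j) (g c j)" using ex by metis
  have d: "\<And>c j. c \<in> S \<Longrightarrow> 0 < d c j"
    and g: "\<And>c j. c \<in> S \<Longrightarrow> g c j \<in> Lp PX p"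
    and gle: "\<And>c j y x. c \<in> S \<Longrightarrow> y \<in> S \<inter> ball c (d c j) \<Longrightarrow> x \<in> space PX \<Longrightarrow> g c j x \<le> f y x"
    and g\<phi>: "\<And>c j. c \<in> S \<Longrightarrow> ?\<phi> c - e j < \<rho> (\<lambda>\<omega>. g c j (\<xi> \<omega>))"
    and \<phi>le: "\<And>c j y. c \<in> S \<Longrightarrow> y \<in> S \<inter> ball c (d c j) \<Longrightarrow> ?\<phi> y < ?\<phi> c + e j"
    using dg unfolding Q_def by blast+
  \<comment> \<open>Lindelof's property leaves countably many centres per tolerance, so the null
    sets of their envelopes can be united.\<close>
  have "\<exists>C. countable C \<and> C \<subseteq> S \<and> S \<subseteq> (\<Union>c\<in>C. ball c (d c j))" for j
  proof -
    have op: "open X" if "X \<in> (\<lambda>c. ball c (d c j)) ` S" for X using that by auto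
    obtain \<F> where \<F>: "\<F> \<subseteq> (\<lambda>c. ball c (d c j)) ` S" "countable \<F>" "\<Union>\<F> = (\<Union>c\<in>S. ball c (d c j))"
      by (rule Lindelof[OF op])
    obtain C where C: "countable C" "C \<subseteq> S" "\<F> = (\<lambda>c. ball c (d c j)) ` C"
      using countable_subset_image[THEN iffD1, OF conjI[OF \<F>(2,1)]] by blast
    have "S \<subseteq> (\<Union>c\<in>S. ball c (d c j))" using d by fastforce
    then show ?thesis using \<F>(3) C by (intro exI[of _ C]) auto
  qed
  then obtain C where C: "\<And>j. countable (C j)" "\<And>j. C j \<subseteq> S" "\<And>j. S \<subseteq> (\<Union>c\<in>C j. ball c (d c j))"
    by metis
  have "AE \<omega> in M. \<forall>c\<in>C j. (\<lambda>N. risk_of_cdf \<rho> G (empirical_cdf (\<lambda>i. g c j (\<xi>s i \<omega>)) N))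
           \<longlonglongrightarrow> \<rho> (\<lambda>\<omega>. g c j (\<xi> \<omega>))" for j
  proof (intro AE_ball_countable[THEN iffD2] ballI C(1))
    fix c assume "c \<in> C j"
    then have "g c j \<in> Lp PX p" using C(2) by (intro g) auto
    with P p \<rho> G M meas law indep \<xi>
    show "AE \<omega> in M. (\<lambda>N. risk_of_cdf \<rho> G (empirical_cdf (\<lambda>i. g c j (\<xi>s i \<omega>)) N))
           \<longlonglongrightarrow> \<rho> (\<lambda>\<omega>. g c j (\<xi> \<omega>))"
      by (rule empirical_risk_tendsto)
  qed
  then have "AE \<omega> in M. \<forall>j. \<forall>c\<in>C j. (\<lambda>N. risk_of_cdf \<rho> G (empirical_cdf (\<lambda>i. g c j (\<xi>s i \<omega>)) N))
           \<longlonglongrightarrow> \<rho> (\<lambda>\<omega>. g c j (\<xi> \<omega>))"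
    by (simp add: AE_all_countable)
  with AE_space show ?thesis
  proof eventually_elim
    case (elim \<omega>)
    have x: "\<xi>s i \<omega> \<in> space PX" if "1 \<le> i" for i
      using measurable_space[OF meas[OF that]] elim(1) by blast
    show ?case
      unfolding locally_liminf_ge_def
    proof (intro ballI allI impI)
      fix y and \<epsilon> :: real assume y: "y \<in> S" and \<epsilon>: "0 < \<epsilon>"
      obtain j where "1 / real (Suc j) < \<epsilon> / 3" using \<epsilon> nat_approx_posE[of "\<epsilon> / 3"] by auto
      \<comment> \<open>One \<open>e j\<close> each for passing from \<open>y\<close> to the centre,
        from the centre to its envelope, and from the envelope to its empirical risk.\<close>
      then have j: "3 * e j < \<epsilon>" by (simp add: e_def)
      obtain c where c: "c \<in> C j" "y \<in> ball c (d c j)" using C(3) y by blast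
      then have cS: "c \<in> S" using C(2) by blast
      have "\<forall>\<^sub>F N in sequentially. \<rho> (\<lambda>\<omega>. g c j (\<xi> \<omega>)) - e j
          < risk_of_cdf \<rho> G (empirical_cdf (\<lambda>i. g c j (\<xi>s i \<omega>)) N)"
        using elim(2) c(1) e[of j] by (intro order_tendstoD(1)) auto
      then have "\<forall>\<^sub>F N in sequentially. \<forall>y'\<in>S \<inter> ball c (d c j).
          ?\<phi> y - \<epsilon> \<le> risk_of_cdf \<rho> G (empirical_cdf (\<lambda>i. f y' (\<xi>s i \<omega>)) N)"
        using eventually_gt_at_top[of 0]
      proof eventually_elim
        case (elim N)
        show ?case
        proof
          fix y' assume y': "y' \<in> S \<inter> ball c (d c j)"
          have "risk_of_cdf \<rho> G (empirical_cdf (\<lambda>i. g c j (\<xi>s i \<omega>)) N)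
              \<le> risk_of_cdf \<rho> G (empirical_cdf (\<lambda>i. f y' (\<xi>s i \<omega>)) N)"
            by (rule empirical_risk_mono[OF \<rho>(1) G elim(2)]) (use gle[OF cS y'] x in auto)
          moreover have "?\<phi> y < ?\<phi> c + e j" using \<phi>le[OF cS, of y j] c(2) y by blast
          ultimately show "?\<phi> y - \<epsilon> \<le> risk_of_cdf \<rho> G (empirical_cdf (\<lambda>i. f y' (\<xi>s i \<omega>)) N)"
            using elim(1) g\<phi>[OF cS, of j] j by linarith
        qed
      qed
      then show "\<exists>U. open U \<and> y \<in> U \<and> (\<forall>\<^sub>F N in sequentially. \<forall>y'\<in>S \<inter> U.
          ?\<phi> y - \<epsilon> \<le> risk_of_cdf \<rho> G (empirical_cdf (\<lambda>i. f y' (\<xi>s i \<omega>)) N))"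
        using c(2) by (intro exI[of _ "ball c (d c j)"]) auto
    qed
  qed
qed

section \<open>Deterministic minimization for a fixed sample\<close>

lemma eventually_less_add:
  fixes a b c :: real
  assumes "\<And>c. c < a \<Longrightarrow> \<forall>\<^sub>F n in F. c < u n" "\<And>c. c < b \<Longrightarrow> \<forall>\<^sub>F n in F. c < v n" "c < a + b"
  shows "\<forall>\<^sub>F n in F. c < u n + v n"
proof -
  let ?d = "(a + b - c) / 2"
  have "\<forall>\<^sub>F n in F. a - ?d < u n" "\<forall>\<^sub>F n in F. b - ?d < v n"
    using assms by auto
  then show ?thesis by eventually_elim (simp add: field_simps)
qed

locale reflexive_problem =
  fixes Zad :: "'z::{banach, second_countable_topology} set"
    and S :: "'y::real_normed_vector set" and B :: "'z \<Rightarrow> 'y" and \<psi> :: "'z \<Rightarrow> real" and \<phi> :: "'y \<Rightarrow> real"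
  assumes refl: "reflexive_space TYPE('z)"
    and Zad: "Zad \<noteq> {}" "closed Zad" "convex Zad" "bounded Zad"
    and B: "completely_continuous B" "B ` Zad \<subseteq> S"
    and \<psi>: "convex_on UNIV \<psi>" "continuous_on UNIV \<psi>"
    and \<phi>: "continuous_on S \<phi>"
begin

abbreviation "J z \<equiv> \<phi> (B z) + \<psi> z"

lemma weak_subseq:
  assumes "\<And>n. zs n \<in> Zad"
  obtains s z where "strict_mono (s :: nat \<Rightarrow> nat)" "z \<in> Zad" "weakly_tendsto (zs \<circ> s) z"
proof -
  have "bounded (range zs)" using assms by (intro bounded_subset[OF Zad(4)]) auto
  then obtain s z where s: "strict_mono (s :: nat \<Rightarrow> nat)" "weakly_tendsto (zs \<circ> s) z"
    using reflexive_bounded_weak_subseq[OF refl] by blast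
  have "z \<in> Zad"
    by (rule weakly_tendsto_closed_convex[OF Zad(2,3) _ s(2)]) (simp add: assms)
  then show ?thesis by (rule that[OF s(1) _ s(2)])
qed

lemma B_tendsto:
  assumes "\<And>n. zs n \<in> Zad" "weakly_tendsto zs z"
  shows "(\<lambda>n. B (zs n)) \<longlonglongrightarrow> B z"
  using B(1) assms(2) by (simp add: completely_continuous_def)

text \<open>The direct method: weak compactness of \<open>Zad\<close>, continuity of
  \<open>\<phi>\<close> after \<open>B\<close>, and weak lower semicontinuity of
  \<open>\<psi>\<close>.\<close>

lemma solution_exists: "solution_set Zad J \<noteq> {}"
proof -
  \<comment> \<open>As an \<open>ereal\<close> the infimum may still be minus infinity here;
    \<open>u\<close> approaches it strictly from above in either case.\<close>
  let ?m = "INF z\<in>Zad. ereal (J z)"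
  obtain z0 where "z0 \<in> Zad" using Zad(1) by blast
  then have "?m \<le> ereal (J z0)" by (rule INF_lower)
  also have "\<dots> < \<infinity>" by simp
  finally obtain u where u: "\<And>n :: nat. ?m < u n" "u \<longlonglongrightarrow> ?m"
    using approx_from_above_dense_linorder[of ?m \<infinity>] by blast
  have "\<exists>z\<in>Zad. ereal (J z) < u n" for n using u(1)[of n] by (simp add: INF_less_iff)
  then obtain zs where zs: "\<And>n. zs n \<in> Zad" "\<And>n. ereal (J (zs n)) < u n" by metis
  obtain s z where s: "strict_mono (s :: nat \<Rightarrow> nat)" and z: "z \<in> Zad" and w: "weakly_tendsto (zs \<circ> s) z"
    using weak_subseq[of zs] zs(1) by blast
  have lsc: "\<forall>\<^sub>F n in sequentially. c < J ((zs \<circ> s) n)" if "c < J z" for c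
  proof (rule eventually_less_add[OF _ _ that])
    have "(\<lambda>n. \<phi> (B ((zs \<circ> s) n))) \<longlonglongrightarrow> \<phi> (B z)"
      using \<phi> B(2) z zs(1) B_tendsto[OF _ w]
      by (intro continuous_on_tendsto_compose[OF \<phi>, of "\<lambda>n. B ((zs \<circ> s) n)"]) (auto simp: image_subset_iff)
    then show "\<forall>\<^sub>F n in sequentially. c < \<phi> (B ((zs \<circ> s) n))" if "c < \<phi> (B z)" for c
      using that by (rule order_tendstoD)
    show "\<forall>\<^sub>F n in sequentially. c < \<psi> ((zs \<circ> s) n)" if "c < \<psi> z" for c
      by (rule convex_weakly_lsc[OF \<psi> w that])
  qed
  have "ereal (J z) \<le> ?m"
  proof (rule ccontr)
    assume "\<not> ereal (J z) \<le> ?m"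
    then obtain c where c: "?m < ereal c" "c < J z"
      using ereal_dense2[of ?m "ereal (J z)"] by (auto simp: not_le)
    have "(\<lambda>n. u (s n)) \<longlonglongrightarrow> ?m" using LIMSEQ_subseq_LIMSEQ[OF u(2) s] by (simp add: comp_def)
    from order_tendstoD(2)[OF this c(1)] lsc[OF c(2)]
    have "\<forall>\<^sub>F n in sequentially. False"
    proof eventually_elim
      case (elim n)
      show ?case using less_trans[OF zs(2)[of "s n"] elim(1)] elim(2) by simp
    qed
    then show False by simp
  qed
  then have "J z \<le> J z'" if "z' \<in> Zad" for z'
    using INF_lower[OF that, of "\<lambda>z. ereal (J z)"] by (metis ereal_less_eq(3) order_trans)
  then show ?thesis using z by (auto simp: solution_set_def)
qed

end

text \<open>What remains of one sample outside the null sets. Convergence of \<open>\<phi>N\<close>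
  is required at the single minimizer \<open>z0\<close>, elsewhere only the lower bound.\<close>

locale reflexive_approximation = reflexive_problem Zad S B \<psi> \<phi>
  for Zad :: "'z::{banach, second_countable_topology} set"
    and S :: "'y::real_normed_vector set" and B and \<psi> and \<phi> +
  fixes \<phi>N :: "nat \<Rightarrow> 'y \<Rightarrow> real" and z0 :: 'z
  assumes lower: "locally_liminf_ge S \<phi>N \<phi>"
    and z0: "z0 \<in> solution_set Zad J"
    and recovery: "(\<lambda>N. \<phi>N N (B z0)) \<longlonglongrightarrow> \<phi> (B z0)"
begin

abbreviation "JN N z \<equiv> \<phi>N N (B z) + \<psi> z"

text \<open>Complete continuity moves \<open>B (zs n)\<close> into the neighbourhood given by
  \<open>lower\<close>. The index map \<open>s\<close> is kept because the points are found only
  along subsequences of the problems.\<close>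

lemma \<phi>N_liminf:
  assumes s: "strict_mono (s :: nat \<Rightarrow> nat)" and zs: "\<And>n. zs n \<in> Zad" and z: "z \<in> Zad"
    and w: "weakly_tendsto zs z" and c: "c < \<phi> (B z)"
  shows "\<forall>\<^sub>F n in sequentially. c < \<phi>N (s n) (B (zs n))"
proof -
  let ?e = "(\<phi> (B z) - c) / 2"
  have "B z \<in> S" using B(2) z by blast
  then obtain U where U: "open U" "B z \<in> U"
      "\<forall>\<^sub>F N in sequentially. \<forall>y'\<in>S \<inter> U. \<phi> (B z) - ?e \<le> \<phi>N N y'"
    using lower c unfolding locally_liminf_ge_def by (metis diff_gt_0_iff_gt half_gt_zero)
  have "\<forall>\<^sub>F n in sequentially. B (zs n) \<in> U"
    using topological_tendstoD[OF B_tendsto[OF zs w] U(1,2)] .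
  moreover have "\<forall>\<^sub>F n in sequentially. \<forall>y'\<in>S \<inter> U. \<phi> (B z) - ?e \<le> \<phi>N (s n) y'"
    by (rule eventually_subseq[OF s U(3)])
  ultimately show ?thesis
  proof eventually_elim
    case (elim n)
    have "B (zs n) \<in> S" using B(2) zs by blast
    with elim have "\<phi> (B z) - ?e \<le> \<phi>N (s n) (B (zs n))" by blast
    then show ?case using c by (simp add: field_simps)
  qed
qed

lemma JN_liminf:
  assumes s: "strict_mono (s :: nat \<Rightarrow> nat)" and zs: "\<And>n. zs n \<in> Zad" and z: "z \<in> Zad"
    and w: "weakly_tendsto zs z" and c: "c < J z"
  shows "\<forall>\<^sub>F n in sequentially. c < JN (s n) (zs n)"
  by (rule eventually_less_add[OF \<phi>N_liminf[OF s zs z w] convex_weakly_lsc[OF \<psi> w] c])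

lemma optimal_value_J: "optimal_value Zad J = ereal (J z0)"
  unfolding optimal_value_def
  using z0 by (intro antisym INF_lower INF_greatest) (auto simp: solution_set_def)

text \<open>Testing with \<open>z0\<close> bounds the values from above. Values staying below
  \<open>c < J z0\<close> would come from points with a weak limit \<open>z\<close>, and
  \<open>JN_liminf\<close> contradicts \<open>c < J z0 \<le> J z\<close>.\<close>

theorem optimal_value_tendsto:
  "(\<lambda>N. optimal_value Zad (JN N)) \<longlonglongrightarrow> optimal_value Zad J"
  unfolding optimal_value_J
proof (rule order_tendstoI)
  fix a assume a: "ereal (J z0) < a"
  have "(\<lambda>N. ereal (JN N z0)) \<longlonglongrightarrow> ereal (J z0)"
    by (intro tendsto_ereal tendsto_add recovery tendsto_const)
  from order_tendstoD(2)[OF this a]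
  show "\<forall>\<^sub>F N in sequentially. optimal_value Zad (JN N) < a"
  proof eventually_elim
    case (elim N)
    have "optimal_value Zad (JN N) \<le> ereal (JN N z0)"
      unfolding optimal_value_def using z0 by (intro INF_lower) (simp add: solution_set_def)
    then show ?case using elim by (rule le_less_trans)
  qed
next
  fix a assume "a < ereal (J z0)"
  then obtain c where c: "a < ereal c" "c < J z0"
    using ereal_dense2[of a "ereal (J z0)"] by auto
  show "\<forall>\<^sub>F N in sequentially. a < optimal_value Zad (JN N)"
  proof (rule ccontr)
    assume "\<not> ?thesis"
    then have "\<exists>\<^sub>F N in sequentially. \<exists>z\<in>Zad. JN N z < c"
      unfolding not_eventually
    proof (rule frequently_elim1)
      fix N assume "\<not> a < optimal_value Zad (JN N)"
      then have "optimal_value Zad (JN N) < ereal c" using c(1) by (simp add: not_less)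
      then show "\<exists>z\<in>Zad. JN N z < c" by (simp add: optimal_value_def INF_less_iff)
    qed
    then obtain s :: "nat \<Rightarrow> nat" where s: "strict_mono s" "\<And>n. \<exists>z\<in>Zad. JN (s n) z < c"
      using frequently_subseq[of "\<lambda>N. \<exists>z\<in>Zad. JN N z < c"] by blast
    then obtain zs where zs: "\<And>n. zs n \<in> Zad" "\<And>n. JN (s n) (zs n) < c" by metis
    obtain r z where r: "strict_mono (r :: nat \<Rightarrow> nat)" and z: "z \<in> Zad" and w: "weakly_tendsto (zs \<circ> r) z"
      using weak_subseq[of zs] zs(1) by blast
    have "c < J z" using c(2) z0 z by (auto simp: solution_set_def intro: less_le_trans)
    moreover have "(zs \<circ> r) n \<in> Zad" for n by (simp add: zs(1))
    ultimately have "\<forall>\<^sub>F n in sequentially. c < JN ((s \<circ> r) n) ((zs \<circ> r) n)"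
      using JN_liminf[OF strict_mono_o[OF s(1) r] _ z w] by blast
    moreover have "\<not> c < JN ((s \<circ> r) n) ((zs \<circ> r) n)" for n
      using zs(2)[of "r n"] by simp
    ultimately show False by (simp add: eventually_False)
  qed
qed

text \<open>Near-minimizers keeping a distance \<open>e\<close> from all solutions would have a weak
  cluster point. It is itself a solution, and the R-property makes the convergence to it
  strong.\<close>

theorem excess_approx_minimizers_tendsto:
  assumes R: "R_function \<psi>" and r: "r \<longlonglongrightarrow> 0"
  shows "(\<lambda>N. excess (approx_minimizers Zad (JN N) (r N)) (solution_set Zad J)) \<longlonglongrightarrow> 0"
proof (rule order_tendstoI)
  fix a :: ennreal assume a: "0 < a"
  obtain e where e: "0 < e" "ennreal e < a"
  proof -
    obtain b where b: "0 < b" "b < a" using dense[OF a] by blast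
    then have "b < \<top>" using less_le_trans top_greatest by blast
    then obtain e where "b = ennreal e" "0 \<le> e" by (cases b) auto
    then show ?thesis using b by (intro that[of e]) (auto simp: ennreal_less_zero_iff)
  qed
  let ?far = "\<lambda>N x. x \<in> approx_minimizers Zad (JN N) (r N) \<and> (\<forall>y\<in>solution_set Zad J. e \<le> norm (x - y))"
  show "\<forall>\<^sub>F N in sequentially. excess (approx_minimizers Zad (JN N) (r N)) (solution_set Zad J) < a"
  proof (rule ccontr)
    assume "\<not> ?thesis"
    then have "\<exists>\<^sub>F N in sequentially. \<exists>x. ?far N x"
      unfolding not_eventually
    proof (rule frequently_elim1)
      fix N assume "\<not> excess (approx_minimizers Zad (JN N) (r N)) (solution_set Zad J) < a"
      then have "ennreal e < excess (approx_minimizers Zad (JN N) (r N)) (solution_set Zad J)"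
        using e(2) by (simp add: not_less)
      then obtain x where x: "x \<in> approx_minimizers Zad (JN N) (r N)"
          "ennreal e < (INF y\<in>solution_set Zad J. ennreal (norm (x - y)))"
        by (auto simp: excess_def less_SUP_iff)
      have "e \<le> norm (x - y)" if "y \<in> solution_set Zad J" for y
      proof -
        have "ennreal e < ennreal (norm (x - y))" using x(2) INF_lower[OF that] by (rule less_le_trans)
        then show ?thesis using e(1) by (simp add: ennreal_less_iff)
      qed
      with x(1) show "\<exists>x. ?far N x" by blast
    qed
    then obtain s :: "nat \<Rightarrow> nat" where s: "strict_mono s" "\<And>n. \<exists>x. ?far (s n) x"
      using frequently_subseq[of "\<lambda>N. \<exists>x. ?far N x"] by blast
    then obtain xs where xs: "\<And>n. ?far (s n) (xs n)" by metis
    then have xZ: "xs n \<in> Zad" for n by (simp add: approx_minimizers_def)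
    obtain q x where q: "strict_mono (q :: nat \<Rightarrow> nat)" and x: "x \<in> Zad" and w: "weakly_tendsto (xs \<circ> q) x"
      using weak_subseq[of xs] xZ by blast
    have sq: "strict_mono (s \<circ> q)" using s(1) q by (rule strict_mono_o)
    have xqZ: "(xs \<circ> q) n \<in> Zad" for n by (simp add: xZ)
    have up: "\<forall>\<^sub>F n in sequentially. JN ((s \<circ> q) n) ((xs \<circ> q) n) < c" if "J z0 < c" for c
    proof -
      have "(\<lambda>N. optimal_value Zad (JN N) + ereal (r N)) \<longlonglongrightarrow> ereal (J z0) + ereal 0"
        using optimal_value_tendsto r unfolding optimal_value_J
        by (intro tendsto_add_ereal tendsto_ereal) auto
      then have "\<forall>\<^sub>F N in sequentially. optimal_value Zad (JN N) + ereal (r N) < ereal c"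
        using that by (intro order_tendstoD(2)) auto
      from eventually_subseq[OF sq this] show ?thesis
      proof eventually_elim
        case (elim n)
        have "ereal (JN ((s \<circ> q) n) ((xs \<circ> q) n)) \<le> optimal_value Zad (JN ((s \<circ> q) n)) + ereal (r ((s \<circ> q) n))"
          using xs[of "q n"] by (simp add: approx_minimizers_def)
        also note elim
        finally show ?case by simp
      qed
    qed
    have "J x \<le> J z0"
    proof (rule ccontr)
      assume "\<not> J x \<le> J z0"
      then obtain c where c: "J z0 < c" "c < J x" using dense by (metis not_le)
      have "\<forall>\<^sub>F n in sequentially. False"
        using up[OF c(1)] JN_liminf[OF sq xqZ x w c(2)] by eventually_elim simp
      then show False by simp
    qed
    then have xs0: "x \<in> solution_set Zad J" and Jx: "J x = J z0"
      using z0 x by (fastforce simp: solution_set_def)+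
    \<comment> \<open>The sum is asymptotically at most \<open>J x\<close> and its risk part at
      least \<open>\<phi> (B x)\<close>, which leaves no room for \<open>\<psi>\<close> above
      \<open>\<psi> x\<close>.\<close>
    have "(\<lambda>n. \<psi> ((xs \<circ> q) n)) \<longlonglongrightarrow> \<psi> x"
    proof (rule order_tendstoI)
      fix c assume "c < \<psi> x"
      then show "\<forall>\<^sub>F n in sequentially. c < \<psi> ((xs \<circ> q) n)" by (rule convex_weakly_lsc[OF \<psi> w])
    next
      fix c assume c: "\<psi> x < c"
      \<comment> \<open>The gap is spent half on the upper bound of the sum and half on the lower
        bound of the risk.\<close>
      let ?d = "(c - \<psi> x) / 2"
      have "\<forall>\<^sub>F n in sequentially. JN ((s \<circ> q) n) ((xs \<circ> q) n) < J z0 + ?d"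
        using c by (intro up) simp
      moreover have "\<forall>\<^sub>F n in sequentially. \<phi> (B x) - ?d < \<phi>N ((s \<circ> q) n) (B ((xs \<circ> q) n))"
        using c by (intro \<phi>N_liminf[OF sq xqZ x w]) simp
      ultimately show "\<forall>\<^sub>F n in sequentially. \<psi> ((xs \<circ> q) n) < c"
      proof eventually_elim
        case (elim n)
        then show ?case using Jx by (simp add: field_simps)
      qed
    qed
    then have "(xs \<circ> q) \<longlonglongrightarrow> x"
      using R w unfolding R_function_def by blast
    then have "\<forall>\<^sub>F n in sequentially. dist ((xs \<circ> q) n) x < e" using e(1) by (rule tendstoD)
    moreover have "\<not> dist ((xs \<circ> q) n) x < e" for n
      using xs[of "q n"] xs0 by (auto simp: dist_norm not_less)
    ultimately show False by (simp add: eventually_False)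
  qed
qed simp

end

theorem theorem11:
  fixes Zad :: "'z::{banach, second_countable_topology} set"
    and Y0 :: "'y::{banach, second_countable_topology} set"
    and p :: real
    and B :: "'z \<Rightarrow> 'y"
    and \<psi> :: "'z \<Rightarrow> real"
    and PX :: "'x::polish_space measure"
    and P :: "'w measure"
    and \<xi> :: "'w \<Rightarrow> 'x"
    and G :: "'w \<Rightarrow> real"
    and f :: "'y \<Rightarrow> 'x \<Rightarrow> real"
    and \<R> :: "('w \<Rightarrow> real) \<Rightarrow> real"
    and P' :: "'v measure"
    and \<xi>s :: "nat \<Rightarrow> 'v \<Rightarrow> 'x"
    and r :: "nat \<Rightarrow> real"
  assumes "reflexive_space TYPE('z)"
    and "Zad \<noteq> {}" and "closed Zad" and "convex Zad" and "bounded Zad"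
    and "closed Y0"
    and "1 \<le> p"
    and "linear B" and "completely_continuous B" and "B ` Zad \<subseteq> Y0"
    and "\<And>z. 0 \<le> \<psi> z" and "convex_on UNIV \<psi>" and "continuous_on UNIV \<psi>"
    and "complete_borel_prob PX"
    and "prob_space P" and "complete_measure P" and "nonatomic P"
    and "\<xi> \<in> P \<rightarrow>\<^sub>M PX" and "distr P PX \<xi> = PX"
    and "uniform01 P G"
    and "caratheodory PX Y0 f"
    and "\<And>y. y \<in> Y0 \<Longrightarrow> f y \<in> Lp PX p"
    and "continuous_into_Lp P p Y0 (\<lambda>y \<omega>. f y (\<xi> \<omega>))"
    and "\<And>y. y \<in> Y0 \<Longrightarrow> \<exists>V h. openin (top_of_set Y0) V \<and> y \<in> V \<and> h \<in> Lp PX p \<and>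
           (\<forall>y'\<in>V. \<forall>x\<in>space PX. h x \<le> f y' x)"
    and "convex_risk_measure P p \<R>" and "law_invariant P p \<R>"
    and "prob_space P'" and "complete_measure P'"
    and "\<And>i. 1 \<le> i \<Longrightarrow> \<xi>s i \<in> P' \<rightarrow>\<^sub>M PX"
    and "\<And>i. 1 \<le> i \<Longrightarrow> distr P' PX (\<xi>s i) = PX"
    and "prob_space.indep_vars P' (\<lambda>_. PX) \<xi>s {1..}"
    and "\<And>N. 0 \<le> r N" and "r \<longlonglongrightarrow> 0"
  shows "(AE \<omega>' in P'.
            (\<lambda>N. optimal_value Zad (empirical_objective \<R> G f (\<lambda>i. \<xi>s i \<omega>') B \<psi> N))
              \<longlonglongrightarrow> optimal_value Zad (true_objective \<R> f \<xi> B \<psi>)) \<and>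
         (R_function \<psi> \<longrightarrow>
           (AE \<omega>' in P'.
             (\<lambda>N. excess
                (approx_minimizers Zad (empirical_objective \<R> G f (\<lambda>i. \<xi>s i \<omega>') B \<psi> N) (r N))
                (solution_set Zad (true_objective \<R> f \<xi> B \<psi>))) \<longlonglongrightarrow> 0))"
proof -
  have p: "0 < p" using assms(7) by simp
  let ?\<phi> = "\<lambda>y. \<R> (\<lambda>\<omega>. f y (\<xi> \<omega>))"
  let ?\<phi>N = "\<lambda>\<omega>' N y. risk_of_cdf \<R> G (empirical_cdf (\<lambda>i. f y (\<xi>s i \<omega>')) N)"
  have cont: "continuous_on Y0 ?\<phi>"
    by (rule continuous_on_risk[OF p \<open>convex_risk_measure P p \<R>\<close>]) fact
  interpret reflexive_problem Zad Y0 B \<psi> ?\<phi>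
    using assms(1-5) assms(9,10) assms(12,13) cont by unfold_locales
  have J: "true_objective \<R> f \<xi> B \<psi> = J"
    by (simp add: true_objective_def fun_eq_iff)
  have JN: "empirical_objective \<R> G f (\<lambda>i. \<xi>s i \<omega>') B \<psi> N = (\<lambda>z. ?\<phi>N \<omega>' N (B z) + \<psi> z)" for N \<omega>'
    by (simp add: empirical_objective_def fun_eq_iff)
  \<comment> \<open>Fixed before the sample, so a single null set covers convergence of its
    empirical risk.\<close>
  obtain z0 where z0: "z0 \<in> solution_set Zad J" using solution_exists by blast
  then have "B z0 \<in> Y0" using B(2) by (auto simp: solution_set_def)
  then have "f (B z0) \<in> Lp PX p" by (rule assms(22))
  with \<open>prob_space P\<close> p \<open>convex_risk_measure P p \<R>\<close> \<open>law_invariant P p \<R>\<close> \<open>uniform01 P G\<close> \<open>prob_space P'\<close>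
    assms(29-31) \<open>\<xi> \<in> P \<rightarrow>\<^sub>M PX\<close> \<open>distr P PX \<xi> = PX\<close>
  have recovery: "AE \<omega>' in P'. (\<lambda>N. ?\<phi>N \<omega>' N (B z0)) \<longlonglongrightarrow> ?\<phi> (B z0)"
    by (rule empirical_risk_tendsto)
  have lower: "AE \<omega>' in P'. locally_liminf_ge Y0 (?\<phi>N \<omega>') ?\<phi>"
    using \<open>prob_space P\<close> p \<open>convex_risk_measure P p \<R>\<close> \<open>law_invariant P p \<R>\<close> \<open>uniform01 P G\<close> \<open>prob_space P'\<close>
      assms(29-31) \<open>\<xi> \<in> P \<rightarrow>\<^sub>M PX\<close> \<open>distr P PX \<xi> = PX\<close> assms(21-24)
    by (rule empirical_risk_locally_liminf_ge)
  \<comment> \<open>Almost every sample is an instance of the deterministic locale, with the same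
    \<open>z0\<close>.\<close>
  have approx: "AE \<omega>' in P'. reflexive_approximation Zad Y0 B \<psi> ?\<phi> (?\<phi>N \<omega>') z0"
    using recovery lower
  proof eventually_elim
    case (elim \<omega>')
    then show ?case using z0 by unfold_locales
  qed
  show ?thesis
    unfolding J JN
  proof (intro conjI impI)
    show "AE \<omega>' in P'. (\<lambda>N. optimal_value Zad (\<lambda>z. ?\<phi>N \<omega>' N (B z) + \<psi> z)) \<longlonglongrightarrow> optimal_value Zad J"
      using approx
      by eventually_elim (rule reflexive_approximation.optimal_value_tendsto)
    assume R: "R_function \<psi>"
    show "AE \<omega>' in P'. (\<lambda>N. excess (approx_minimizers Zad (\<lambda>z. ?\<phi>N \<omega>' N (B z) + \<psi> z) (r N))
        (solution_set Zad J)) \<longlonglongrightarrow> 0"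
      using approx
    proof eventually_elim
      case (elim \<omega>')
      then show ?case
        using R \<open>r \<longlonglongrightarrow> 0\<close> by (rule reflexive_approximation.excess_approx_minimizers_tendsto)
    qed
  qed
qed

end
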